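(* Let $K_1,K_2\subset\mathbb{R}^n$ be $n$-dimensional convex polyhedra such that $0\in K_1\cap K_2$ and $\operatorname{Int}(K_1)\cap\operatorname{Int}(K_2)=\varnothing$. Assume that there exists a Nash arc $\alpha:[-1,1]\to K_1\cup K_2$ such that $\alpha(0)=0$, $\alpha([-1,0))\subset\operatorname{Int}(K_1)$ and $\alpha((0,1])\subset\operatorname{Int}(K_2)$. Then there exist $e\in\{1,2\}$, an integer $d$ with $e\leq d\leq n$, a real number $\varepsilon>0$ and an invertible affine change of coordinates $\varphi:\mathbb{R}^n\to\mathbb{R}^n$ with $\varphi(0)=0$ such that the polynomial arc $\beta:=(\beta_1,\ldots,\beta_n):[-\varepsilon,\varepsilon]\to\mathbb{R}^n$ given by $$\beta_k(t)=\begin{cases}t^{e+k-1}&\text{if }k=1,\ldots,d,\\0&\text{if }k=d+1,\ldots,n,\end{cases}$$ satisfies $\beta([-\varepsilon,\varepsilon])\subset\varphi(K_1)\cup\varphi(K_2)$, $\beta(0)=0$, $\beta([-\varepsilon,0))\subset\operatorname{Int}(\varphi(K_1))$ and $\beta((0,\varepsilon])\subset\operatorname{Int}(\varphi(K_2))$.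
   Context: A convex polyhedron in $\mathbb{R}^n$ is a finite intersection of closed half-spaces (possibly unbounded). $\operatorname{Int}$ denotes the interior in $\mathbb{R}^n$. A Nash arc $\alpha:[-1,1]\to\mathbb{R}^n$ is a Nash map, that is, a map that extends to a $C^\infty$ map with semialgebraic graph on an open interval containing $[-1,1]$. *)

theory Defs
  imports "HOL-Analysis.Analysis"
begin

(* On a Euclidean space, real_polynomial_function describes exactly the polynomials
   in the coordinates.  Sets {x. p x = 0} are covered: they are the complement of
   {x. p x > 0} \<union> {x. - p x > 0}. *)
inductive semialgebraic :: "'a::euclidean_space set \<Rightarrow> bool" where
  pos: "real_polynomial_function p \<Longrightarrow> semialgebraic {x. p x > 0}"
| Compl: "semialgebraic S \<Longrightarrow> semialgebraic (- S)"
| Un: "semialgebraic S \<Longrightarrow> semialgebraic T \<Longrightarrow> semialgebraic (S \<union> T)"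
| Int: "semialgebraic S \<Longrightarrow> semialgebraic T \<Longrightarrow> semialgebraic (S \<inter> T)"

(* Intended for open I.  D k is the k-th derivative of f on I; existence of
   all derivatives makes each of them continuous on I. *)
definition C_infinity_on :: "(real \<Rightarrow> 'a::real_normed_vector) \<Rightarrow> real set \<Rightarrow> bool" where
  "C_infinity_on f I \<longleftrightarrow>
     (\<exists>D :: nat \<Rightarrow> real \<Rightarrow> 'a. (\<forall>t\<in>I. D 0 t = f t) \<and>
        (\<forall>k. \<forall>t\<in>I. (D k has_vector_derivative D (Suc k) t) (at t)))"

definition Nash_arc :: "(real \<Rightarrow> 'a::euclidean_space) \<Rightarrow> bool" where
  "Nash_arc \<alpha> \<longleftrightarrow>
     (\<exists>I g. open I \<and> is_interval I \<and> {-1..1} \<subseteq> I \<and>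
        (\<forall>t\<in>{-1..1}. g t = \<alpha> t) \<and>
        C_infinity_on g I \<and> semialgebraic {(t, g t) | t. t \<in> I})"

definition invertible_affine :: "(real ^ 'n \<Rightarrow> real ^ 'n) \<Rightarrow> bool" where
  "invertible_affine \<phi> \<longleftrightarrow> (\<exists>A b. invertible A \<and> \<phi> = (\<lambda>x. A *v x + b))"

(* pos numbers the coordinates by 1, ..., n, since the index type 'n carries no order. *)
definition power_arc :: "('n::finite \<Rightarrow> nat) \<Rightarrow> nat \<Rightarrow> nat \<Rightarrow> real \<Rightarrow> real ^ 'n" where
  "power_arc pos e d t = (\<chi> i. if pos i \<le> d then t ^ (e + pos i - 1) else 0)"

end

theory Submission
  imports Defs
begin

text \<open>
  Near the common point \<open>0\<close> the interior of each polyhedron is given by finitely many strict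
  homogeneous linear inequalities \<open>l \<bullet> x > 0\<close>, so the whole question concerns the signs of the
  functions \<open>l \<bullet> \<alpha> t\<close> on the two sides of \<open>0\<close>.

  Such a function is not flat at \<open>0\<close>.  Indeed it satisfies a nontrivial polynomial equation
  \<open>R (t, l \<bullet> \<alpha> t) = 0\<close> (\<open>semialgebraic_function_algebraic\<close>), and an algebraic germ that is flat at \<open>0\<close>
  vanishes (\<open>algebraic_flat_germ_vanishes\<close>).  The equation is obtained without quantifier
  elimination.  Membership in the graph depends only on the signs of finitely many polynomials,
  hence \<open>\<alpha> t\<close> is an isolated zero of the sum of the squares of those polynomials that vanish at
  \<open>(t, \<alpha> t)\<close>.  An isolated zero of a nonnegative polynomial \<open>P\<close> is a limit of critical points of
  \<open>P + \<delta> * (\<Sum>i. x\<^sub>i ^ (2 * d + 2) / (2 * d + 2))\<close> as \<open>\<delta>\<close> tends to \<open>0\<close>.  The critical equations express high powers of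
  the coordinates by terms of lower degree, so that all polynomials in \<open>x\<close> reduce to a module of
  finite rank over the polynomials in \<open>t\<close> and \<open>\<delta>\<close>; linear dependence in that module gives the
  equation, uniformly in \<open>t\<close>.

  By Taylor's theorem the sign of \<open>l \<bullet> \<alpha> t\<close> for small \<open>t > 0\<close> is that of the first nonzero number
  among \<open>l \<bullet> \<alpha>\<^sup>(\<^sup>k\<^sup>) 0\<close>, and for small \<open>t < 0\<close> the same holds with the factors \<open>(-1) ^ k\<close>.  Thus the
  derivatives of \<open>\<alpha>\<close> at \<open>0\<close>, each with the sign \<open>(-1) ^ k\<close>, form a finite list of signed vectors on
  which every inequality is lexicographically positive (\<open>signed_flag\<close>).  Two moves shorten such
  a list: a vector in the span of its predecessors can be removed, and two adjacent vectors \<open>u\<close>, \<open>w\<close>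
  of equal sign can be replaced by \<open>u + \<epsilon> w\<close> with a small \<open>\<epsilon> > 0\<close>.  When neither applies, the vectors are
  linearly independent and the signs alternate, so they are the signs of the consecutive powers
  \<open>t ^ e, t ^ (e + 1), \<dots>\<close> with \<open>e = 1\<close> or \<open>e = 2\<close>.  The polynomial arc with these vectors as coefficients
  therefore runs through the same two interiors, and a linear change of coordinates that sends
  the vectors to the standard basis turns it into the power arc.  Disjointness of the interiors excludes
  the empty list and, for \<open>e = 2\<close>, a list of length one: in both cases a single direction would point
  into both interiors.
\<close>

section \<open>Linear dependence over an integral domain\<close>

text \<open>
  Gaussian elimination of one equation at a time, with cross-multiplication by the pivot in
  place of division.
\<close>
lemma idom_linear_dependence:
  fixes v :: "'k \<Rightarrow> 'b \<Rightarrow> 'a::idom"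
  assumes "finite B" "finite K" "card B < card K"
  shows "\<exists>c. (\<exists>k\<in>K. c k \<noteq> 0) \<and> (\<forall>b\<in>B. (\<Sum>k\<in>K. c k * v k b) = 0)"
  using assms
proof (induction B arbitrary: K v rule: finite_induct)
  case empty
  then obtain k where "k \<in> K" by fastforce
  then show ?case by (intro exI[of _ "\<lambda>_. 1"]) auto
next
  case (insert b B)
  show ?case
  proof (cases "\<forall>k\<in>K. v k b = 0")
    case True
    have "card B < card K" using insert by simp
    then obtain c where "\<exists>k\<in>K. c k \<noteq> 0" "\<forall>b\<in>B. (\<Sum>k\<in>K. c k * v k b) = 0"
      using insert.IH[OF insert.prems(1)] by blast
    then show ?thesis using True by (intro exI[of _ c]) auto
  next
    case False
    then obtain p where p: "p \<in> K" "v p b \<noteq> 0" by blast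
    define K' where "K' = K - {p}"
    have K': "finite K'" "card B < card K'" "p \<notin> K'" "K = insert p K'"
      using insert p unfolding K'_def by auto
    obtain c where c: "\<exists>k\<in>K'. c k \<noteq> 0"
      "\<forall>b'\<in>B. (\<Sum>k\<in>K'. c k * (v p b * v k b' - v k b * v p b')) = 0"
      using insert.IH[OF K'(1,2), of "\<lambda>k b'. v p b * v k b' - v k b * v p b'"] by blast
    define c' where "c' k = (if k = p then - (\<Sum>k\<in>K'. c k * v k b) else v p b * c k)" for k
    have sum_c': "(\<Sum>k\<in>K. c' k * v k b') = (\<Sum>k\<in>K'. c k * (v p b * v k b' - v k b * v p b'))" for b'
    proof -
      have "(\<Sum>k\<in>K. c' k * v k b') = c' p * v p b' + (\<Sum>k\<in>K'. c' k * v k b')"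
        using K' by simp
      also have "(\<Sum>k\<in>K'. c' k * v k b') = (\<Sum>k\<in>K'. v p b * c k * v k b')"
        using K'(3) by (intro sum.cong) (auto simp: c'_def)
      also have "c' p * v p b' = - (\<Sum>k\<in>K'. c k * v k b * v p b')"
        by (simp add: c'_def sum_distrib_right)
      finally show ?thesis
        by (simp add: right_diff_distrib sum_subtractf mult_ac)
    qed
    have "\<exists>k\<in>K. c' k \<noteq> 0" using c(1) K'(3,4) p(2) by (auto simp: c'_def)
    moreover have "\<forall>b'\<in>insert b B. (\<Sum>k\<in>K. c' k * v k b') = 0"
      unfolding sum_c' using c(2) by (auto simp: mult.commute)
    ultimately show ?thesis by blast
  qed
qed

section \<open>Polynomials with a parameter\<close>

text \<open>
  Monomials are indexed by exponent functions, since the index type carries no order.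
\<close>
definition mon :: "('n::finite \<Rightarrow> nat) \<Rightarrow> real ^ 'n \<Rightarrow> real" where
  "mon c x = (\<Prod>i\<in>UNIV. x $ i ^ c i)"

definition exponent_sum :: "('n::finite \<Rightarrow> nat) \<Rightarrow> nat" where
  "exponent_sum c = (\<Sum>i\<in>UNIV. c i)"

text \<open>
  Polynomials in \<open>x\<close> of total degree at most \<open>d\<close> whose coefficients are polynomials in the
  parameter \<open>t\<close>.  Only the degree in \<open>x\<close> is recorded, because the reduction below lowers that degree
  and does not control the degree in \<open>t\<close>.
\<close>
inductive param_poly :: "nat \<Rightarrow> (real \<Rightarrow> real ^ 'n \<Rightarrow> real) \<Rightarrow> bool" for d where
  mon: "exponent_sum c \<le> d \<Longrightarrow> param_poly d (\<lambda>t x. poly a t * mon c x)"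
| add: "param_poly d h \<Longrightarrow> param_poly d k \<Longrightarrow> param_poly d (\<lambda>t x. h t x + k t x)"

lemma mon_add: "mon (\<lambda>i. c i + c' i) x = mon c x * mon c' x"
  by (simp add: mon_def power_add prod.distrib)

lemma exponent_sum_add: "exponent_sum (\<lambda>i. c i + c' i) = exponent_sum c + exponent_sum c'"
  by (simp add: exponent_sum_def sum.distrib)

lemma mon_split: "mon c x = x $ i ^ c i * (\<Prod>j\<in>UNIV - {i}. x $ j ^ c j)"
  unfolding mon_def by (simp add: prod.remove)

lemma exponent_sum_split: "exponent_sum c = c i + (\<Sum>j\<in>UNIV - {i}. c j)"
  unfolding exponent_sum_def by (simp add: sum.remove)

lemma param_poly_mono: "param_poly d h \<Longrightarrow> d \<le> d' \<Longrightarrow> param_poly d' h"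
  by (induction rule: param_poly.induct) (auto intro: param_poly.intros)

lemma param_poly_mult:
  assumes "param_poly d h" "param_poly d' k"
  shows "param_poly (d + d') (\<lambda>t x. h t x * k t x)"
  using assms(1)
proof (induction rule: param_poly.induct)
  case (mon c a)
  show ?case using assms(2)
  proof (induction rule: param_poly.induct)
    case (mon c' a')
    have "(\<lambda>t x. poly a t * mon c x * (poly a' t * mon c' x))
        = (\<lambda>t x. poly (a * a') t * mon (\<lambda>i. c i + c' i) x)"
      by (simp add: mon_add fun_eq_iff)
    then show ?case using mon \<open>exponent_sum c \<le> d\<close>
      by (simp only:) (intro param_poly.mon, simp add: exponent_sum_add)
  next
    case (add h k)
    from param_poly.add[OF add.IH] show ?case by (simp add: distrib_left)
  qed
next
  case (add h k)
  from param_poly.add[OF add.IH] show ?case by (simp add: distrib_right)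
qed

lemma param_poly_const: "param_poly d (\<lambda>t x. poly a t)"
  using param_poly.mon[of "\<lambda>_. 0" d a] by (simp add: mon_def exponent_sum_def)

lemma param_poly_coord: "param_poly 1 (\<lambda>t (x :: real ^ 'n). x $ i)"
proof -
  define c where "c = (\<lambda>j. if j = i then 1 else 0 :: nat)"
  have "mon c x = x $ i" for x :: "real ^ 'n"
    using mon_split[of c x i] by (simp add: c_def)
  moreover have "exponent_sum c = 1" by (simp add: exponent_sum_def c_def)
  ultimately show ?thesis using param_poly.mon[of c 1 1] by simp
qed

lemma param_poly_sum:
  "finite A \<Longrightarrow> (\<And>j. j \<in> A \<Longrightarrow> param_poly d (h j)) \<Longrightarrow> param_poly d (\<lambda>t x. \<Sum>j\<in>A. h j t x)"
proof (induction A rule: finite_induct)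
  case empty
  show ?case using param_poly_const[of d 0] by simp
qed (auto intro: param_poly.add)

lemma param_poly_power:
  "param_poly d h \<Longrightarrow> param_poly (d * k) (\<lambda>t x. h t x ^ k)"
proof (induction k)
  case 0
  show ?case using param_poly_const[of 0 1] by simp
next
  case (Suc k)
  then show ?case using param_poly_mult[of d h "d * k" "\<lambda>t x. h t x ^ k"] by simp
qed

lemma real_polynomial_function_param_poly:
  fixes p :: "real \<times> (real ^ 'n) \<Rightarrow> real"
  assumes "real_polynomial_function p"
  shows "\<exists>d. param_poly d (\<lambda>t x. p (t, x))"
  using assms
proof (induction rule: real_polynomial_function.induct)
  case (linear p)
  then interpret bounded_linear p .
  have "(\<lambda>t x. p (t, x)) = (\<lambda>t x. poly [:0, p (1, 0):] t
      + (\<Sum>i\<in>UNIV. poly [:p (0, axis i 1):] t * (x :: real ^ 'n) $ i))"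
  proof (intro ext)
    fix t and x :: "real ^ 'n"
    have "(t, x) = t *\<^sub>R (1, 0) + (\<Sum>i\<in>UNIV. x $ i *\<^sub>R (0, axis i 1))"
    proof (rule prod_eqI)
      show "snd (t, x) = snd (t *\<^sub>R (1, 0) + (\<Sum>i\<in>UNIV. x $ i *\<^sub>R (0 :: real, axis i 1)))"
        using basis_expansion[of x] by (simp only: snd_add snd_scaleR snd_sum snd_conv
            scalar_mult_eq_scaleR scaleR_zero_right add_0)
    qed (simp add: fst_sum)
    then have "p (t, x) = p (t *\<^sub>R (1, 0) + (\<Sum>i\<in>UNIV. x $ i *\<^sub>R (0, axis i 1)))" by simp
    also have "\<dots> = t * p (1, 0) + (\<Sum>i\<in>UNIV. x $ i * p (0, axis i 1))"
      by (simp only: add scaleR sum real_scaleR_def)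
    finally show "p (t, x) = poly [:0, p (1, 0):] t
        + (\<Sum>i\<in>UNIV. poly [:p (0, axis i 1):] t * x $ i)"
      by (simp add: mult.commute)
  qed
  moreover have "param_poly 1 (\<lambda>t x. poly [:0, p (1, 0):] t
      + (\<Sum>i\<in>UNIV. poly [:p (0, axis i 1):] t * (x :: real ^ 'n) $ i))"
  proof (intro param_poly.add param_poly_sum param_poly_const)
    fix i
    show "param_poly 1 (\<lambda>t x. poly [:p (0, axis i 1):] t * (x :: real ^ 'n) $ i)"
      using param_poly_mult[OF param_poly_const[of 0] param_poly_coord] by (simp only: add_0)
  qed simp
  ultimately have "param_poly 1 (\<lambda>t x. p (t, x))" by (rule ssubst[where P = "param_poly 1"])
  then show ?case by blast
next
  case (const c)
  show ?case using param_poly_const[of 0 "[:c:]"] by auto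
next
  case (add p q)
  then obtain d e where "param_poly d (\<lambda>t x. p (t, x))" "param_poly e (\<lambda>t x. q (t, x))" by blast
  from this[THEN param_poly_mono, of "max d e"]
  have "param_poly (max d e) (\<lambda>t x. p (t, x) + q (t, x))"
    by (intro param_poly.add) simp_all
  then show ?case by blast
next
  case (mult p q)
  then obtain d e where "param_poly d (\<lambda>t x. p (t, x))" "param_poly e (\<lambda>t x. q (t, x))" by blast
  from param_poly_mult[OF this] show ?case by blast
qed

lemma param_poly_continuous: "param_poly d h \<Longrightarrow> continuous_on A (h t)"
  by (induction rule: param_poly.induct) (auto simp: mon_def intro!: continuous_intros)

text \<open>
  The degree does not drop by one in this bound: that is enough below, where the perturbation
  has a degree well above that of the derivative.
\<close>
lemma param_poly_partial_derivative:
  fixes h :: "real \<Rightarrow> real ^ 'n \<Rightarrow> real"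
  assumes "param_poly d h"
  shows "\<exists>h'. param_poly d h' \<and>
    (\<forall>t x. ((\<lambda>s. h t (x + s *\<^sub>R axis i 1)) has_real_derivative h' t x) (at 0))"
  using assms
proof (induction rule: param_poly.induct)
  case (mon c a)
  define c' where "c' = c(i := c i - 1)"
  have le: "exponent_sum c' \<le> d"
    using mon exponent_sum_split[of c i] exponent_sum_split[of c' i] by (simp add: c'_def)
  have "((\<lambda>s. poly a t * mon c (x + s *\<^sub>R axis i 1)) has_real_derivative
      poly (smult (of_nat (c i)) a) t * mon c' x) (at 0)" for t and x :: "real ^ 'n"
  proof -
    define r where "r = (\<Prod>j\<in>UNIV - {i}. x $ j ^ c j)"
    have rest: "(\<Prod>j\<in>UNIV - {i}. (x + s *\<^sub>R axis i 1) $ j ^ c j) = r" for s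
      unfolding r_def by (rule prod.cong) (auto simp: axis_def)
    have "mon c (x + s *\<^sub>R axis i 1) = (x $ i + s) ^ c i * r" for s
      using mon_split[of c "x + s *\<^sub>R axis i 1" i] unfolding rest by simp
    moreover have "mon c' x = x $ i ^ (c i - 1) * r"
      using mon_split[of c' x i] by (simp add: c'_def r_def)
    ultimately show ?thesis
      by (auto intro!: derivative_eq_intros simp: mult_ac)
  qed
  then show ?case using param_poly.mon[OF le] by blast
next
  case (add h k)
  then obtain h' k' where "param_poly d h'" "param_poly d k'"
    "\<forall>t x. ((\<lambda>s. h t (x + s *\<^sub>R axis i 1)) has_real_derivative h' t x) (at 0)"
    "\<forall>t x. ((\<lambda>s. k t (x + s *\<^sub>R axis i 1)) has_real_derivative k' t x) (at 0)" by blast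
  then show ?case
    by (intro exI[of _ "\<lambda>t x. h' t x + k' t x"])
      (auto intro: param_poly.add intro!: derivative_eq_intros)
qed

section \<open>Elimination\<close>

text \<open>
  The outer variable is evaluated at \<open>y\<close> and the coefficients at \<open>t\<close>.  The outer variable is
  the perturbation \<open>\<delta>\<close> in the elimination and the function value in the resulting equation.
\<close>
definition eval2 :: "real poly poly \<Rightarrow> real \<Rightarrow> real \<Rightarrow> real" where
  "eval2 p t y = poly (poly p [:y:]) t"

lemma eval2_simps [simp]:
  "eval2 0 t y = 0" "eval2 1 t y = 1"
  "eval2 (p + q) t y = eval2 p t y + eval2 q t y"
  "eval2 (p * q) t y = eval2 p t y * eval2 q t y"
  "eval2 [:a:] t y = poly a t"
  "eval2 (monom a k) t y = poly a t * y ^ k"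
  by (simp_all add: eval2_def poly_monom)

lemma eval2_pCons: "eval2 (pCons a p) t y = poly a t + y * eval2 p t y"
  by (simp add: eval2_def)

lemma eval2_sum: "eval2 (\<Sum>k\<in>A. p k) t y = (\<Sum>k\<in>A. eval2 (p k) t y)"
  by (induction A rule: infinite_finite_induct) auto

lemma eval2_prod: "eval2 (\<Prod>k\<in>A. p k) t y = (\<Prod>k\<in>A. eval2 (p k) t y)"
  by (induction A rule: infinite_finite_induct) auto

lemma eval2_at_0: "eval2 p t 0 = poly (coeff p 0) t"
  by (cases p) (simp add: eval2_pCons)

lemma continuous_eval2 [continuous_intros]:
  "continuous_on A f \<Longrightarrow> continuous_on A (\<lambda>z. eval2 p t (f z))"
  by (induction p) (auto simp: eval2_pCons intro!: continuous_intros)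

lemma finite_exponent_box: "finite {c :: 'n::finite \<Rightarrow> nat. \<forall>i. c i < M}"
  using finite_PiE[of "UNIV :: 'n set" "\<lambda>_. {..<M}"]
  by (simp add: PiE_def Pi_def)

text \<open>
  With \<open>Q i\<close> equal to minus the \<open>i\<close>-th partial derivative of \<open>P\<close>, these are the equations for a critical
  point of \<open>P + \<delta> * (\<Sum>i. x\<^sub>i ^ (M + 1) / (M + 1))\<close>.
\<close>
definition critical :: "('n::finite \<Rightarrow> real \<Rightarrow> real ^ 'n \<Rightarrow> real) \<Rightarrow> nat \<Rightarrow> real \<Rightarrow> real \<Rightarrow> real ^ 'n \<Rightarrow> bool"
  where "critical Q M t \<delta> x \<longleftrightarrow> (\<forall>i. \<delta> * x $ i ^ M = Q i t x)"

text \<open>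
  On critical points a factor \<open>x\<^sub>i ^ M\<close> may be traded, at the cost of one factor \<open>\<delta>\<close>, for \<open>Q i\<close>,
  whose degree is smaller than \<open>M\<close>.  Induction on the degree therefore reaches the finitely many
  monomials with all exponents below \<open>M\<close>.
\<close>
lemma reduction_to_box:
  fixes Q :: "'n::finite \<Rightarrow> real \<Rightarrow> real ^ 'n \<Rightarrow> real"
  assumes Q: "\<And>i. param_poly d (Q i)" and "d < M"
  shows "param_poly n h \<Longrightarrow> \<exists>k v. \<forall>t \<delta> x. critical Q M t \<delta> x \<longrightarrow>
    \<delta> ^ k * h t x = (\<Sum>c | \<forall>i. c i < M. eval2 (v c) t \<delta> * mon c x)"
proof (induction n arbitrary: h rule: less_induct)
  case (less n)
  let ?B = "{c :: 'n \<Rightarrow> nat. \<forall>i. c i < M}"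
  from less.prems show ?case
  proof (induction rule: param_poly.induct)
    case (mon c a)
    show ?case
    proof (cases "c \<in> ?B")
      case True
      define v where "v c' = (if c' = c then [:a:] else 0)" for c'
      have "(\<Sum>c\<in>?B. eval2 (v c) t \<delta> * mon c x) = (\<Sum>c'\<in>?B. if c' = c then poly a t * mon c x else 0)"
        for t \<delta> x by (intro sum.cong) (auto simp: v_def)
      then have "(\<Sum>c\<in>?B. eval2 (v c) t \<delta> * mon c x) = \<delta> ^ 0 * (poly a t * mon c x)" for t \<delta> x
        using True by (simp add: finite_exponent_box)
      then show ?thesis by (intro exI[of _ 0] exI[of _ v]) simp
    next
      case False
      then obtain i where i: "M \<le> c i" by (auto simp: not_less)
      define c' where "c' = c(i := c i - M)"
      have mon_c: "mon c x = mon c' x * x $ i ^ M" for x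
      proof -
        have "x $ i ^ c i = x $ i ^ (c i - M) * x $ i ^ M" using i by (simp flip: power_add)
        then show ?thesis
          using mon_split[of c x i] mon_split[of c' x i] by (simp add: c'_def mult_ac)
      qed
      have "exponent_sum c = exponent_sum c' + M"
        using exponent_sum_split[of c i] exponent_sum_split[of c' i] i by (simp add: c'_def)
      then have "exponent_sum c' + d < n" using mon \<open>d < M\<close> by linarith
      moreover have "param_poly (exponent_sum c' + d) (\<lambda>t x. poly a t * mon c' x * Q i t x)"
        by (intro param_poly_mult Q param_poly.mon) simp
      ultimately obtain k v where "\<forall>t \<delta> x. critical Q M t \<delta> x \<longrightarrow>
          \<delta> ^ k * (poly a t * mon c' x * Q i t x) = (\<Sum>c\<in>?B. eval2 (v c) t \<delta> * mon c x)"
        using less.IH by blast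
      moreover have "\<delta> ^ Suc k * (poly a t * mon c x) = \<delta> ^ k * (poly a t * mon c' x * Q i t x)"
        if "critical Q M t \<delta> x" for t \<delta> x
      proof -
        have "\<delta> * x $ i ^ M = Q i t x" using that by (simp add: critical_def)
        then show ?thesis by (simp add: mon_c mult_ac flip: \<open>\<delta> * x $ i ^ M = Q i t x\<close>)
      qed
      ultimately show ?thesis by (intro exI[of _ "Suc k"] exI[of _ v]) simp
    qed
  next
    case (add h1 h2)
    then obtain k1 v1 k2 v2 where
      1: "\<forall>t \<delta> x. critical Q M t \<delta> x \<longrightarrow>
        \<delta> ^ k1 * h1 t x = (\<Sum>c\<in>?B. eval2 (v1 c) t \<delta> * mon c x)" and
      2: "\<forall>t \<delta> x. critical Q M t \<delta> x \<longrightarrow>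
        \<delta> ^ k2 * h2 t x = (\<Sum>c\<in>?B. eval2 (v2 c) t \<delta> * mon c x)" by blast
    define v where "v c = monom 1 k2 * v1 c + monom 1 k1 * v2 c" for c
    have "\<delta> ^ (k1 + k2) * (h1 t x + h2 t x) = (\<Sum>c\<in>?B. eval2 (v c) t \<delta> * mon c x)"
      if "critical Q M t \<delta> x" for t \<delta> x
    proof -
      have "(\<Sum>c\<in>?B. eval2 (v c) t \<delta> * mon c x)
          = \<delta> ^ k2 * (\<Sum>c\<in>?B. eval2 (v1 c) t \<delta> * mon c x)
          + \<delta> ^ k1 * (\<Sum>c\<in>?B. eval2 (v2 c) t \<delta> * mon c x)"
        by (simp add: v_def sum_distrib_left distrib_right sum.distrib mult.assoc)
      also have "\<dots> = \<delta> ^ k2 * (\<delta> ^ k1 * h1 t x) + \<delta> ^ k1 * (\<delta> ^ k2 * h2 t x)"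
        using 1 2 that by simp
      finally show ?thesis by (simp add: algebra_simps power_add)
    qed
    then show ?case by blast
  qed
qed

text \<open>
  After multiplication by powers of \<open>\<delta>\<close>, the powers \<open>h ^ k\<close> are infinitely many elements of a module
  generated by the finitely many monomials of the box, so enough of them are dependent.  The
  relation depends neither on \<open>t\<close> nor on \<open>\<delta>\<close>.
\<close>
lemma critical_values_algebraic:
  fixes Q :: "'n::finite \<Rightarrow> real \<Rightarrow> real ^ 'n \<Rightarrow> real"
  assumes Q: "\<And>i. param_poly d (Q i)" and "d < M" and h: "param_poly n h"
  shows "\<exists>m C. (\<exists>k\<le>m. C k \<noteq> 0) \<and> (\<forall>t \<delta> x. critical Q M t \<delta> x \<longrightarrow>
    (\<Sum>k\<le>m. eval2 (C k) t \<delta> * h t x ^ k) = 0)"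
proof -
  let ?B = "{c :: 'n \<Rightarrow> nat. \<forall>i. c i < M}"
  have "\<forall>k. \<exists>e v. \<forall>t \<delta> x. critical Q M t \<delta> x \<longrightarrow>
      \<delta> ^ e * h t x ^ k = (\<Sum>c\<in>?B. eval2 (v c) t \<delta> * mon c x)"
    by (intro allI reduction_to_box[of d Q M, OF _ _ param_poly_power[OF h]] Q \<open>d < M\<close>)
  then obtain e v where ev: "\<And>k t \<delta> x. critical Q M t \<delta> x \<Longrightarrow>
      \<delta> ^ e k * h t x ^ k = (\<Sum>c\<in>?B. eval2 (v k c) t \<delta> * mon c x)"
    unfolding choice_iff by blast
  obtain C where C: "\<exists>k\<in>{..card ?B}. C k \<noteq> 0"
    "\<forall>c\<in>?B. (\<Sum>k\<in>{..card ?B}. C k * v k c) = 0"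
    using idom_linear_dependence[OF finite_exponent_box, of "{..card ?B}" M v] by auto
  have "(\<Sum>k\<le>card ?B. eval2 (C k * monom 1 (e k)) t \<delta> * h t x ^ k) = 0"
    if crit: "critical Q M t \<delta> x" for t \<delta> x
  proof -
    have "(\<Sum>k\<le>card ?B. eval2 (C k * monom 1 (e k)) t \<delta> * h t x ^ k)
        = (\<Sum>k\<le>card ?B. eval2 (C k) t \<delta> * (\<delta> ^ e k * h t x ^ k))"
      by (simp add: mult.assoc)
    also have "\<dots> = (\<Sum>k\<le>card ?B. \<Sum>c\<in>?B. eval2 (C k * v k c) t \<delta> * mon c x)"
      by (simp add: ev[OF crit] sum_distrib_left mult.assoc)
    also have "\<dots> = (\<Sum>c\<in>?B. eval2 (\<Sum>k\<le>card ?B. C k * v k c) t \<delta> * mon c x)"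
      by (subst sum.swap) (simp add: eval2_sum sum_distrib_right)
    also have "\<dots> = 0" using C(2) by simp
    finally show ?thesis .
  qed
  moreover have "\<exists>k\<le>card ?B. C k * monom 1 (e k) \<noteq> 0" using C(1) by (auto simp: monom_eq_0_iff)
  ultimately show ?thesis
    by (intro exI[of _ "card ?B"] exI[of _ "\<lambda>k. C k * monom 1 (e k)"]) simp
qed

text \<open>
  Setting \<open>\<delta> = 0\<close> in the relation for critical values could make it trivial.  It is first divided
  by the largest power of \<open>\<delta>\<close> common to all its coefficients; the quotient still vanishes at
  critical points, where \<open>\<delta> > 0\<close>, and its value at \<open>\<delta> = 0\<close> is nontrivial.
\<close>
lemma limits_of_critical_values_algebraic:
  fixes Q :: "'n::finite \<Rightarrow> real \<Rightarrow> real ^ 'n \<Rightarrow> real"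
  assumes Q: "\<And>i. param_poly d (Q i)" and "d < M" and h: "param_poly n h"
  shows "\<exists>R. R \<noteq> 0 \<and> (\<forall>t x0. (\<forall>\<eta>>0. \<exists>\<delta> x. 0 < \<delta> \<and> \<delta> < \<eta> \<and> dist x x0 < \<eta> \<and> critical Q M t \<delta> x) \<longrightarrow>
    eval2 R t (h t x0) = 0)"
proof -
  obtain m C where "\<exists>k\<le>m. C k \<noteq> 0" and C: "\<forall>t \<delta> x. critical Q M t \<delta> x \<longrightarrow>
      (\<Sum>k\<le>m. eval2 (C k) t \<delta> * h t x ^ k) = 0"
    using critical_values_algebraic[of d Q M n h, OF assms] by (elim exE, elim conjE) (rule that)
  then obtain k where "k \<le> m" "C k \<noteq> 0" by blast
  define r where "r = (LEAST r. \<exists>k\<le>m. coeff (C k) r \<noteq> 0)"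
  have "\<exists>r. \<exists>k\<le>m. coeff (C k) r \<noteq> 0" 
    using leading_coeff_neq_0[OF \<open>C k \<noteq> 0\<close>] \<open>k \<le> m\<close> by (intro exI conjI)
  then have r: "\<exists>k\<le>m. coeff (C k) r \<noteq> 0" unfolding r_def by (rule LeastI_ex)
  have below: "coeff (C k) j = 0" if "k \<le> m" "j < r" for k j
    using not_less_Least[OF that(2)[unfolded r_def]] that(1) by blast
  have "\<forall>k\<in>{..m}. \<exists>q. C k = monom 1 r * q"
  proof
    fix k assume "k \<in> {..m}"
    then have "monom 1 r dvd C k" using below by (simp add: monom_1_dvd_iff')
    then show "\<exists>q. C k = monom 1 r * q" by (rule dvdE) blast
  qed
  from bchoice[OF this] obtain C' where C': "\<And>k. k \<le> m \<Longrightarrow> C k = monom 1 r * C' k" by auto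
  have coeff_C': "coeff (C' k) 0 = coeff (C k) r" if "k \<le> m" for k
    using C'[OF that] by (simp add: coeff_monom_mult)
  define R where "R = (\<Sum>k\<le>m. monom (coeff (C' k) 0) k)"
  have "coeff R k = coeff (C' k) 0" if "k \<le> m" for k
    using that by (simp add: R_def coeff_sum)
  then have "R \<noteq> 0" using r coeff_C' by force
  moreover have "eval2 R t (h t x0) = 0"
    if x0: "\<forall>\<eta>>0. \<exists>\<delta> x. 0 < \<delta> \<and> \<delta> < \<eta> \<and> dist x x0 < \<eta> \<and> critical Q M t \<delta> x" for t x0
  proof -
    define F where "F z = (\<Sum>k\<le>m. eval2 (C' k) t (fst z) * h t (snd z) ^ k)" for z
    have "continuous_on UNIV (\<lambda>z. h t (snd z))"
      by (rule continuous_on_compose2[OF param_poly_continuous[OF h, of UNIV]])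
        (auto intro: continuous_intros)
    then have "continuous_on UNIV F"
      unfolding F_def by (intro continuous_intros) auto
    have "\<forall>N. \<exists>\<delta> x. 0 < \<delta> \<and> \<delta> < inverse (real (Suc N)) \<and> dist x x0 < inverse (real (Suc N))
        \<and> critical Q M t \<delta> x"
      using x0 by simp
    then obtain D X where DX: "\<And>N. 0 < D N \<and> D N < inverse (real (Suc N))
        \<and> dist (X N) x0 < inverse (real (Suc N)) \<and> critical Q M t (D N) (X N)"
      unfolding choice_iff by blast
    have "F (D N, X N) = 0" for N
    proof -
      have "0 = (\<Sum>k\<le>m. eval2 (C k) t (D N) * h t (X N) ^ k)" using C DX by simp
      also have "\<dots> = D N ^ r * F (D N, X N)"
        by (simp add: F_def C' sum_distrib_left mult.assoc)
      finally show ?thesis using DX[of N] by auto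
    qed
    moreover have "(\<lambda>N. (D N, X N)) \<longlonglongrightarrow> (0, x0)"
    proof (rule tendsto_Pair)
      show "D \<longlonglongrightarrow> 0"
        by (rule Lim_null_comparison[OF _ LIMSEQ_inverse_real_of_nat])
          (use DX in \<open>auto intro!: always_eventually less_imp_le simp: abs_of_pos\<close>)
      show "X \<longlonglongrightarrow> x0"
        by (subst tendsto_dist_iff, rule Lim_null_comparison[OF _ LIMSEQ_inverse_real_of_nat])
          (use DX in \<open>auto intro!: always_eventually less_imp_le\<close>)
    qed
    then have "(\<lambda>N. F (D N, X N)) \<longlonglongrightarrow> F (0, x0)"
      by (rule continuous_on_tendsto_compose[OF \<open>continuous_on UNIV F\<close>]) auto
    ultimately have "F (0, x0) = 0" by (simp add: LIMSEQ_const_iff)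
    then show ?thesis by (simp add: R_def F_def eval2_sum eval2_at_0)
  qed
  ultimately show ?thesis by blast
qed

text \<open>
  A minimiser of the perturbed polynomial on a small ball around the isolated zero lies inside the
  ball once \<open>\<delta>\<close> is small, because \<open>P\<close> is bounded below by a positive constant on the sphere.  It is
  therefore a critical point, and it comes arbitrarily close to the zero.  The perturbation also makes
  the critical equations finite in the sense of the reduction above, although \<open>P\<close> itself may have
  critical sets of positive dimension.
\<close>
lemma isolated_zeros_algebraic:
  fixes P :: "real \<Rightarrow> real ^ 'n \<Rightarrow> real"
  assumes P: "param_poly d P" and nonneg: "\<And>t x. P t x \<ge> 0" and h: "param_poly n h"
  shows "\<exists>R. R \<noteq> 0 \<and> (\<forall>t x0 \<rho>. \<rho> > 0 \<longrightarrow> P t x0 = 0 \<longrightarrow>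
    (\<forall>x. dist x x0 \<le> \<rho> \<longrightarrow> P t x = 0 \<longrightarrow> x = x0) \<longrightarrow> eval2 R t (h t x0) = 0)"
proof -
  have "\<forall>i. \<exists>P'. param_poly d P' \<and>
    (\<forall>t x. ((\<lambda>s. P t (x + s *\<^sub>R axis i 1)) has_real_derivative P' t x) (at 0))"
    using param_poly_partial_derivative[OF P] by blast
  then obtain P' where P': "\<And>i. param_poly d (P' i)"
    "\<And>i t x. ((\<lambda>s. P t (x + s *\<^sub>R axis i 1)) has_real_derivative P' i t x) (at 0)"
    unfolding choice_iff by blast
  define Q where "Q i t x = poly [:-1:] t * P' i t x" for i t and x :: "real ^ 'n"
  have Q: "param_poly d (Q i)" for i
    unfolding Q_def using param_poly_mult[OF param_poly_const[of 0] P'(1)] by (simp only: add_0)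
  \<comment> \<open>An odd exponent beyond the degree of the derivatives; its successor is even, so \<open>V\<close> is nonnegative.\<close>
  define M where "M = 2 * d + 1"
  define V where "V x = (\<Sum>i\<in>UNIV. x $ i ^ Suc M / Suc M)" for x :: "real ^ 'n"
  have "\<exists>\<delta> x. 0 < \<delta> \<and> \<delta> < \<eta> \<and> dist x x0 < \<eta> \<and> critical Q M t \<delta> x"
    if "\<rho> > 0" "\<eta> > 0" and zero: "P t x0 = 0"
      and isolated: "\<And>x. dist x x0 \<le> \<rho> \<Longrightarrow> P t x = 0 \<Longrightarrow> x = x0" for t x0 \<rho> \<eta>
  proof -
    define r where "r = min \<rho> \<eta>"
    have "r > 0" using that by (simp add: r_def)
    have contP: "continuous_on A (P t)" for A by (rule param_poly_continuous[OF P])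
    have contV: "continuous_on A V" for A unfolding V_def by (intro continuous_intros) auto
    have V_nonneg: "V x \<ge> 0" for x
      unfolding V_def M_def by (intro sum_nonneg divide_nonneg_nonneg zero_le_even_power) auto
    have "sphere x0 r \<noteq> {}" using \<open>r > 0\<close> by simp
    then obtain y where y: "y \<in> sphere x0 r" "\<And>x. x \<in> sphere x0 r \<Longrightarrow> P t y \<le> P t x"
      using continuous_attains_inf[OF compact_sphere _ contP] by blast
    have "P t y \<noteq> 0" using isolated[of y] y(1) \<open>r > 0\<close> by (auto simp: r_def dist_commute)
    then have "P t y > 0" using nonneg[of t y] by simp
    \<comment> \<open>Small enough that the perturbed value at \<open>x0\<close> stays below all values on the sphere.\<close>
    define \<delta> where "\<delta> = min (\<eta> / 2) (P t y / (V x0 + 1))"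
    have \<delta>: "0 < \<delta>" "\<delta> < \<eta>"
      using \<open>P t y > 0\<close> V_nonneg[of x0] \<open>\<eta> > 0\<close> by (auto simp: \<delta>_def intro!: divide_pos_pos)
    have "\<delta> * V x0 < P t y"
    proof -
      have "\<delta> * V x0 < \<delta> * (V x0 + 1)" using \<delta> by simp
      also have "\<dots> \<le> P t y / (V x0 + 1) * (V x0 + 1)"
        using V_nonneg[of x0] by (intro mult_right_mono) (auto simp: \<delta>_def)
      also have "\<dots> = P t y" using V_nonneg[of x0] by simp
      finally show ?thesis .
    qed
    have "cball x0 r \<noteq> {}" using \<open>r > 0\<close> by simp
    moreover have "continuous_on (cball x0 r) (\<lambda>x. P t x + \<delta> * V x)"
      by (intro continuous_intros contP contV)
    ultimately obtain x where x: "x \<in> cball x0 r"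
      "\<And>z. z \<in> cball x0 r \<Longrightarrow> P t x + \<delta> * V x \<le> P t z + \<delta> * V z"
      using continuous_attains_inf[OF compact_cball] by blast
    have "P t x + \<delta> * V x \<le> \<delta> * V x0" using x(2)[of x0] \<open>r > 0\<close> zero by simp
    then have "P t x < P t y"
      using \<open>\<delta> * V x0 < P t y\<close> V_nonneg[of x] \<delta> by (smt (verit) mult_nonneg_nonneg)
    then have "x \<notin> sphere x0 r" using y(2) by force
    then have inside: "dist x0 x < r" using x(1) by auto
    have "\<delta> * x $ i ^ M = Q i t x" for i
    proof -
      have V_line: "V (x + s *\<^sub>R axis i 1)
          = (x $ i + s) ^ Suc M / Suc M + (\<Sum>j\<in>UNIV - {i}. x $ j ^ Suc M / Suc M)" for s
      proof -
        have "V (x + s *\<^sub>R axis i 1) = (x + s *\<^sub>R axis i 1) $ i ^ Suc M / Suc M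
            + (\<Sum>j\<in>UNIV - {i}. (x + s *\<^sub>R axis i 1) $ j ^ Suc M / Suc M)"
          unfolding V_def by (rule sum.remove) auto
        also have "(\<Sum>j\<in>UNIV - {i}. (x + s *\<^sub>R axis i 1) $ j ^ Suc M / Suc M)
            = (\<Sum>j\<in>UNIV - {i}. x $ j ^ Suc M / Suc M)"
          by (rule sum.cong) (auto simp: axis_def)
        finally show ?thesis by simp
      qed
      have "((\<lambda>s. V (x + s *\<^sub>R axis i 1)) has_real_derivative x $ i ^ M) (at 0)"
        unfolding V_line
        by (auto intro!: derivative_eq_intros simp del: power_Suc of_nat_Suc)
      then have "((\<lambda>s. P t (x + s *\<^sub>R axis i 1) + \<delta> * V (x + s *\<^sub>R axis i 1))
          has_real_derivative P' i t x + \<delta> * x $ i ^ M) (at 0)"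
        by (auto intro!: derivative_eq_intros P'(2))
      moreover have "P t (x + 0 *\<^sub>R axis i 1) + \<delta> * V (x + 0 *\<^sub>R axis i 1)
          \<le> P t (x + s *\<^sub>R axis i 1) + \<delta> * V (x + s *\<^sub>R axis i 1)"
        if "\<bar>0 - s\<bar> < r - dist x0 x" for s
      proof -
        have "dist x0 (x + s *\<^sub>R axis i 1) \<le> dist x0 x + dist x (x + s *\<^sub>R axis i 1)"
          by (rule dist_triangle)
        also have "dist x (x + s *\<^sub>R axis i 1) = \<bar>s\<bar>" by (simp add: dist_norm)
        finally show ?thesis using x(2) that by simp
      qed
      ultimately have "P' i t x + \<delta> * x $ i ^ M = 0"
        using DERIV_local_min[of _ "P' i t x + \<delta> * x $ i ^ M" 0 "r - dist x0 x"] inside by auto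
      then show ?thesis by (simp add: Q_def)
    qed
    moreover have "dist x x0 < \<eta>" using inside by (simp add: r_def dist_commute)
    ultimately show ?thesis using \<delta> unfolding critical_def by blast
  qed
  moreover obtain R where "R \<noteq> 0" "\<And>t x0. (\<forall>\<eta>>0. \<exists>\<delta> x. 0 < \<delta> \<and> \<delta> < \<eta> \<and> dist x x0 < \<eta>
      \<and> critical Q M t \<delta> x) \<Longrightarrow> eval2 R t (h t x0) = 0"
    using limits_of_critical_values_algebraic[of d Q M n h, OF Q _ h]
    by (auto simp: M_def)
  ultimately show ?thesis by (intro exI[of _ R]) blast
qed

section \<open>Semialgebraic functions\<close>

lemma semialgebraic_sign_determined:
  assumes "semialgebraic S"
  shows "\<exists>F. finite F \<and> (\<forall>p\<in>F. real_polynomial_function p) \<and>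
    (\<forall>z z'. (\<forall>p\<in>F. sgn (p z) = sgn (p z')) \<longrightarrow> z \<in> S \<longrightarrow> z' \<in> S)"
  using assms
proof (induction rule: semialgebraic.induct)
  case (pos p)
  then show ?case by (intro exI[of _ "{p}"]) (auto simp: sgn_if split: if_splits)
next
  case (Compl S)
  then obtain F where "finite F" "\<forall>p\<in>F. real_polynomial_function p"
    "\<forall>z z'. (\<forall>p\<in>F. sgn (p z) = sgn (p z')) \<longrightarrow> z \<in> S \<longrightarrow> z' \<in> S" by blast
  then show ?case by (intro exI[of _ F]) (metis ComplD ComplI)
next
  case (Un S T)
  then obtain F G where "finite F" "\<forall>p\<in>F. real_polynomial_function p"
    "\<forall>z z'. (\<forall>p\<in>F. sgn (p z) = sgn (p z')) \<longrightarrow> z \<in> S \<longrightarrow> z' \<in> S"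
    "finite G" "\<forall>p\<in>G. real_polynomial_function p"
    "\<forall>z z'. (\<forall>p\<in>G. sgn (p z) = sgn (p z')) \<longrightarrow> z \<in> T \<longrightarrow> z' \<in> T" by auto
  then show ?case by (intro exI[of _ "F \<union> G"]) (auto, (meson UnI1 UnI2)+)
next
  case (Int S T)
  then obtain F G where "finite F" "\<forall>p\<in>F. real_polynomial_function p"
    "\<forall>z z'. (\<forall>p\<in>F. sgn (p z) = sgn (p z')) \<longrightarrow> z \<in> S \<longrightarrow> z' \<in> S"
    "finite G" "\<forall>p\<in>G. real_polynomial_function p"
    "\<forall>z z'. (\<forall>p\<in>G. sgn (p z) = sgn (p z')) \<longrightarrow> z \<in> T \<longrightarrow> z' \<in> T" by auto
  then show ?case by (intro exI[of _ "F \<union> G"]) (auto, (meson UnI1 UnI2)+)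
qed

text \<open>
  Fix \<open>t\<close> and let \<open>Z\<close> be the set of those defining polynomials that vanish at \<open>(t, g t)\<close>.  Near \<open>g t\<close> the other
  ones keep their signs, so a nearby common zero of \<open>Z\<close> in the fibre over \<open>t\<close> belongs to the graph
  and hence is \<open>g t\<close>.  This gives an equation for each of the finitely many sets \<open>Z\<close>, and the product
  of these equations serves all \<open>t\<close> at once.
\<close>
lemma semialgebraic_function_algebraic:
  fixes g :: "real \<Rightarrow> real ^ 'n"
  assumes "semialgebraic {(t, g t) | t. t \<in> I}" and h: "param_poly n h"
  shows "\<exists>R. R \<noteq> 0 \<and> (\<forall>t\<in>I. eval2 R t (h t (g t)) = 0)"
proof -
  obtain F where F: "finite F" "\<forall>p\<in>F. real_polynomial_function p"
    "\<And>z z'. (\<forall>p\<in>F. sgn (p z) = sgn (p z')) \<Longrightarrow> z \<in> {(t, g t) | t. t \<in> I}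
      \<Longrightarrow> z' \<in> {(t, g t) | t. t \<in> I}"
    using semialgebraic_sign_determined[OF assms(1)] by blast
  define P where "P Z t x = (\<Sum>p\<in>Z. p (t, x) ^ 2)" for Z :: "(real \<times> (real ^ 'n) \<Rightarrow> real) set"
    and t x
  \<comment> \<open>The product below needs an equation that does not depend on \<open>t\<close>, hence one for each set \<open>Z\<close>.\<close>
  define annihilates where "annihilates R Z \<longleftrightarrow> R \<noteq> 0 \<and> (\<forall>t x0 \<rho>. \<rho> > 0 \<longrightarrow> P Z t x0 = 0 \<longrightarrow>
    (\<forall>x. dist x x0 \<le> \<rho> \<longrightarrow> P Z t x = 0 \<longrightarrow> x = x0) \<longrightarrow> eval2 R t (h t x0) = 0)" for R Z
  have "\<forall>Z\<in>Pow F. \<exists>R. annihilates R Z"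
  proof
    fix Z assume "Z \<in> Pow F"
    then have "real_polynomial_function (\<lambda>z. \<Sum>p\<in>Z. p z ^ 2)"
      using F(1,2) by (intro real_polynomial_function_sum real_polynomial_function_power)
        (auto intro: finite_subset)
    then obtain d where "param_poly d (P Z)"
      using real_polynomial_function_param_poly unfolding P_def by blast
    then show "\<exists>R. annihilates R Z" unfolding annihilates_def
      by (rule isolated_zeros_algebraic[OF _ _ h]) (simp add: P_def sum_nonneg)
  qed
  from bchoice[OF this] obtain R where R: "\<And>Z. Z \<in> Pow F \<Longrightarrow> annihilates (R Z) Z" by blast
  have "eval2 (\<Prod>Z\<in>Pow F. R Z) t (h t (g t)) = 0" if "t \<in> I" for t
  proof -
    define Z where "Z = {p \<in> F. p (t, g t) = 0}"
    have P_zero: "P Z t x = 0 \<longleftrightarrow> (\<forall>p\<in>Z. p (t, x) = 0)" for x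
      unfolding P_def using F(1) by (subst sum_nonneg_eq_0_iff) (auto simp: Z_def)
    have "\<exists>\<rho>>0. \<forall>x. dist x (g t) < \<rho> \<longrightarrow> (\<forall>p\<in>F - Z. sgn (p (t, x)) = sgn (p (t, g t)))"
    proof -
      have "\<forall>\<^sub>F x in nhds (g t). sgn (p (t, x)) = sgn (p (t, g t))" if p: "p \<in> F - Z" for p
      proof -
        have "isCont (\<lambda>x. (t, x)) (g t)"
          by (intro continuous_Pair continuous_const continuous_ident)
        moreover have "isCont p (t, g t)"
          using p F(2) by (intro continuous_real_polymonial_function) blast
        ultimately have "isCont (\<lambda>x. p (t, x)) (g t)" by (rule isCont_o2)
        then have lim: "((\<lambda>x. p (t, x)) \<longlongrightarrow> p (t, g t)) (nhds (g t))"
          unfolding isCont_def by (rule tendsto_at_iff_tendsto_nhds[THEN iffD1])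
        have "p (t, g t) > 0 \<or> p (t, g t) < 0" using p by (auto simp: Z_def)
        then show ?thesis
        proof
          assume "p (t, g t) > 0"
          with order_tendstoD(1)[OF lim this] show ?thesis
            by (elim eventually_mono) simp
        next
          assume "p (t, g t) < 0"
          with order_tendstoD(2)[OF lim this] show ?thesis
            by (elim eventually_mono) simp
        qed
      qed
      then have "\<forall>\<^sub>F x in nhds (g t). \<forall>p\<in>F - Z. sgn (p (t, x)) = sgn (p (t, g t))"
        using F(1) by (intro eventually_ball_finite) auto
      then show ?thesis by (simp add: eventually_nhds_metric)
    qed
    then obtain \<rho> where \<rho>: "\<rho> > 0"
      "\<And>x p. dist x (g t) < \<rho> \<Longrightarrow> p \<in> F - Z \<Longrightarrow> sgn (p (t, x)) = sgn (p (t, g t))" by blast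
    have isolated: "x = g t" if "dist x (g t) \<le> \<rho> / 2" "P Z t x = 0" for x
    proof -
      have "dist x (g t) < \<rho>" using that(1) \<rho>(1) by linarith
      have "\<forall>p\<in>F. sgn (p (t, g t)) = sgn (p (t, x))"
      proof
        fix p assume "p \<in> F"
        show "sgn (p (t, g t)) = sgn (p (t, x))"
        proof (cases "p \<in> Z")
          case True
          then have "p (t, x) = 0" "p (t, g t) = 0" using that(2) P_zero by (auto simp: Z_def)
          then show ?thesis by simp
        next
          case False
          with \<open>p \<in> F\<close> show ?thesis using \<rho>(2)[OF \<open>dist x (g t) < \<rho>\<close>, of p] by simp
        qed
      qed
      from F(3)[OF this] \<open>t \<in> I\<close> show ?thesis by auto
    qed
    have "Z \<in> Pow F" by (auto simp: Z_def)
    moreover have "P Z t (g t) = 0" unfolding P_zero by (auto simp: Z_def)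
    ultimately have "eval2 (R Z) t (h t (g t)) = 0"
      using R[of Z, unfolded annihilates_def, THEN conjunct2, rule_format, of "\<rho> / 2" t "g t"]
        \<rho>(1) isolated by simp
    then show ?thesis
      using F(1) \<open>Z \<in> Pow F\<close> unfolding eval2_prod by (intro prod_zero) auto
  qed
  moreover have "(\<Prod>Z\<in>Pow F. R Z) \<noteq> 0" using R F(1) by (simp add: annihilates_def)
  ultimately show ?thesis by blast
qed

section \<open>Leading terms of algebraic germs\<close>

text \<open>
  Powers of the second variable can be cancelled from \<open>R\<close> where \<open>f\<close> is nonzero.  Then the constant
  coefficient \<open>a\<close> is nonzero and has some finite order \<open>s\<close> at \<open>0\<close>.  Since \<open>a\<close> equals, up to sign, \<open>f\<close> times a bounded
  factor, the quotient \<open>f t / t ^ s\<close> cannot tend to \<open>0\<close> along nonzero values of \<open>f\<close>.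
\<close>
lemma algebraic_flat_germ_vanishes:
  fixes f :: "real \<Rightarrow> real"
  assumes "R \<noteq> 0" and root: "\<forall>\<^sub>F t in at 0. f t = 0 \<or> eval2 R t (f t) = 0"
    and flat: "\<And>n. ((\<lambda>t. f t / t ^ n) \<longlongrightarrow> 0) (at 0)"
  shows "\<forall>\<^sub>F t in at 0. f t = 0"
  using assms(1,2)
proof (induction R)
  case 0
  then show ?case by simp
next
  case (pCons a p)
  have f_lim: "(f \<longlongrightarrow> 0) (at 0)" using flat[of 0] by simp
  show ?case
  proof (cases "a = 0")
    case True
    have "\<forall>\<^sub>F t in at 0. f t = 0 \<or> eval2 p t (f t) = 0"
      using pCons.prems(2) by (rule eventually_mono) (simp add: True eval2_pCons)
    moreover have "p \<noteq> 0" using True pCons.prems(1) by auto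
    ultimately show ?thesis by (intro pCons.IH)
  next
    case False
    obtain q where q: "a = [:-0, 1:] ^ order 0 a * q" "\<not> [:-0, 1:] dvd q"
      using order_decomp[OF False] by blast
    define s where "s = order 0 a"
    have "poly q 0 \<noteq> 0" using q(2) poly_eq_0_iff_dvd[of q 0] by simp
    have poly_a: "poly a t = t ^ s * poly q t" for t
      by (subst q(1)) (simp add: s_def)
    \<comment> \<open>Convergence serves as boundedness: the first factor below tends to 0.\<close>
    have "\<exists>L. ((\<lambda>t. eval2 p' t (f t)) \<longlongrightarrow> L) (at 0)" for p'
    proof (induction p')
      case 0
      show ?case by (auto intro: tendsto_const)
    next
      case (pCons b p')
      then obtain L where "((\<lambda>t. eval2 p' t (f t)) \<longlongrightarrow> L) (at 0)" by blast
      then have "((\<lambda>t. eval2 (pCons b p') t (f t)) \<longlongrightarrow> poly b 0 + 0 * L) (at 0)"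
        unfolding eval2_pCons by (intro tendsto_intros f_lim)
      then show ?case by blast
    qed
    then obtain L where "((\<lambda>t. eval2 p t (f t)) \<longlongrightarrow> L) (at 0)" by blast
    then have "((\<lambda>t. poly q t + f t / t ^ s * eval2 p t (f t)) \<longlongrightarrow> poly q 0 + 0 * L) (at 0)"
      by (intro tendsto_intros flat)
    then have "\<forall>\<^sub>F t in at 0. poly q t + f t / t ^ s * eval2 p t (f t) \<noteq> 0"
      using \<open>poly q 0 \<noteq> 0\<close> by (intro tendsto_imp_eventually_ne) auto
    moreover have "\<forall>\<^sub>F t in at 0. t \<noteq> (0 :: real)" by (simp add: eventually_at_filter)
    ultimately show ?thesis using pCons.prems(2)
    proof eventually_elim
      case (elim t)
      have "eval2 (pCons a p) t (f t) = t ^ s * (poly q t + f t / t ^ s * eval2 p t (f t))"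
        using elim(2) by (simp add: eval2_pCons poly_a distrib_left)
      then show ?case using elim by auto
    qed
  qed
qed

lemma taylor_leading_term:
  fixes D :: "nat \<Rightarrow> real \<Rightarrow> real"
  assumes "r > 0" and deriv: "\<And>k t. \<bar>t\<bar> < r \<Longrightarrow> (D k has_real_derivative D (Suc k) t) (at t)"
    and vanish: "\<And>j. j < n \<Longrightarrow> D j 0 = 0"
  shows "((\<lambda>t. D 0 t / t ^ n) \<longlongrightarrow> D n 0 / fact n) (at 0)"
proof -
  have "\<exists>\<xi>. \<bar>\<xi>\<bar> \<le> \<bar>t\<bar> \<and> D 0 t = D n \<xi> / fact n * t ^ n" if "\<bar>t\<bar> < r" for t
    using Maclaurin_bi_le[of D "D 0" n t] deriv that vanish by auto
  then obtain \<xi> where \<xi>: "\<And>t. \<bar>t\<bar> < r \<Longrightarrow> \<bar>\<xi> t\<bar> \<le> \<bar>t\<bar>"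
    "\<And>t. \<bar>t\<bar> < r \<Longrightarrow> D 0 t = D n (\<xi> t) / fact n * t ^ n" by metis
  have small: "\<forall>\<^sub>F t in at 0. \<bar>t\<bar> < r" using \<open>r > 0\<close>
    by (auto simp: eventually_at intro!: exI[of _ r])
  have "(\<xi> \<longlongrightarrow> 0) (at 0)"
  proof (rule Lim_null_comparison)
    show "\<forall>\<^sub>F t in at 0. norm (\<xi> t) \<le> \<bar>t\<bar>" using small by eventually_elim (simp add: \<xi>)
    show "((\<lambda>t. \<bar>t\<bar>) \<longlongrightarrow> (0 :: real)) (at 0)" by (auto intro!: tendsto_eq_intros)
  qed
  moreover have "isCont (D n) 0" using deriv[of 0] \<open>r > 0\<close> by (auto intro: DERIV_isCont)
  ultimately have "((\<lambda>t. D n (\<xi> t)) \<longlongrightarrow> D n 0) (at 0)" by (rule isCont_tendsto_compose[rotated])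
  then have "((\<lambda>t. D n (\<xi> t) / fact n) \<longlongrightarrow> D n 0 / fact n) (at 0)"
    by (intro tendsto_intros) auto
  moreover have "\<forall>\<^sub>F t in at 0. t \<noteq> (0 :: real)" by (simp add: eventually_at_filter)
  with small have "\<forall>\<^sub>F t in at 0. D n (\<xi> t) / fact n = D 0 t / t ^ n"
    by eventually_elim (simp add: \<xi>(2))
  ultimately show ?thesis by (simp cong: tendsto_cong)
qed

lemma algebraic_leading_term:
  fixes D :: "nat \<Rightarrow> real \<Rightarrow> real"
  assumes "r > 0" and deriv: "\<And>k t. \<bar>t\<bar> < r \<Longrightarrow> (D k has_real_derivative D (Suc k) t) (at t)"
    and "R \<noteq> 0" and root: "\<And>t. \<bar>t\<bar> < r \<Longrightarrow> eval2 R t (D 0 t) = 0"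
    and nonzero: "\<exists>\<^sub>F t in at 0. D 0 t \<noteq> 0"
  shows "\<exists>m. D m 0 \<noteq> 0 \<and> (\<forall>j<m. D j 0 = 0) \<and>
    ((\<lambda>t. D 0 t / t ^ m) \<longlongrightarrow> D m 0 / fact m) (at 0)"
proof -
  have "\<exists>m. D m 0 \<noteq> 0"
  proof (rule ccontr)
    assume "\<nexists>m. D m 0 \<noteq> 0"
    then have "((\<lambda>t. D 0 t / t ^ n) \<longlongrightarrow> 0) (at 0)" for n
      using taylor_leading_term[of r D n] assms(1) deriv by simp
    moreover have "\<forall>\<^sub>F t in at 0. D 0 t = 0 \<or> eval2 R t (D 0 t) = 0"
      using root \<open>r > 0\<close> by (auto simp: eventually_at intro!: exI[of _ r])
    ultimately have "\<forall>\<^sub>F t in at 0. D 0 t = 0"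
      using \<open>R \<noteq> 0\<close> by (intro algebraic_flat_germ_vanishes)
    then show False using nonzero by (simp add: frequently_def)
  qed
  then have "D (LEAST m. D m 0 \<noteq> 0) 0 \<noteq> 0" by (rule LeastI_ex)
  moreover have "D j 0 = 0" if "j < (LEAST m. D m 0 \<noteq> 0)" for j
    using not_less_Least[OF that] by simp
  ultimately show ?thesis using taylor_leading_term[of r D] assms(1) deriv by blast
qed

text \<open>
  Only the limit is available, which gives weak inequalities; they are strict because the
  coefficient is nonzero.
\<close>
lemma leading_coefficient_signs:
  fixes f :: "real \<Rightarrow> real"
  assumes lim: "((\<lambda>t. f t / t ^ m) \<longlongrightarrow> c) (at 0)" and "c \<noteq> 0"
  shows "\<forall>\<^sub>F t in at_right 0. f t > 0 \<Longrightarrow> c > 0"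
    and "\<forall>\<^sub>F t in at_right 0. f (- t) > 0 \<Longrightarrow> (-1) ^ m * c > 0"
proof -
  assume pos: "\<forall>\<^sub>F t in at_right 0. f t > 0"
  have "((\<lambda>t. f t / t ^ m) \<longlongrightarrow> c) (at_right 0)"
    using lim by (rule filterlim_mono) (simp_all add: at_le)
  moreover from pos eventually_at_right_less[of "0 :: real"]
  have "\<forall>\<^sub>F t in at_right 0. 0 \<le> f t / t ^ m" by eventually_elim simp
  ultimately have "0 \<le> c" by (rule tendsto_lowerbound) simp
  then show "c > 0" using \<open>c \<noteq> 0\<close> by simp
next
  assume pos: "\<forall>\<^sub>F t in at_right 0. f (- t) > 0"
  have "filterlim (\<lambda>t :: real. - t) (at 0) (at_right 0)"
    unfolding filterlim_at
    by (auto intro!: tendsto_eq_intros simp: eventually_at_filter)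
  from filterlim_compose[OF lim this]
  have "((\<lambda>t. (-1) ^ m * (f (- t) / (- t) ^ m)) \<longlongrightarrow> (-1) ^ m * c) (at_right 0)"
    by (intro tendsto_intros)
  moreover from pos eventually_at_right_less[of "0 :: real"]
  have "\<forall>\<^sub>F t in at_right 0. 0 \<le> (-1) ^ m * (f (- t) / (- t) ^ m)"
  proof eventually_elim
    case (elim t)
    have "(- t) ^ m = (-1) ^ m * t ^ m" by (rule power_minus)
    then have "(-1) ^ m * (f (- t) / (- t) ^ m) = f (- t) / t ^ m"
      by (cases "even m") simp_all
    then show ?case using elim by simp
  qed
  ultimately have "0 \<le> (-1) ^ m * c" by (rule tendsto_lowerbound) simp
  then show "(-1) ^ m * c > 0" using \<open>c \<noteq> 0\<close> by (simp add: order.order_iff_strict)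
qed

section \<open>Lexicographic positivity\<close>

text \<open>
  The first nonzero entry exists and is positive.
\<close>
fun lexpos :: "real list \<Rightarrow> bool" where
  "lexpos [] \<longleftrightarrow> False"
| "lexpos (x # xs) \<longleftrightarrow> x > 0 \<or> x = 0 \<and> lexpos xs"

lemma lexpos_append:
  "lexpos (xs @ ys) \<longleftrightarrow> lexpos xs \<or> (\<forall>x\<in>set xs. x = 0) \<and> lexpos ys"
  by (induction xs) auto

lemma lexpos_map_upt:
  assumes "m < N" "h m > 0" "\<And>j. j < m \<Longrightarrow> h j = 0"
  shows "lexpos (map h [0..<N])"
proof -
  have "[0..<N] = [0..<m] @ m # [Suc m..<N]" using assms(1)
    using upt_add_eq_append[of 0 m "N - m"] by (simp add: upt_conv_Cons)
  then show ?thesis using assms by (simp add: lexpos_append)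
qed

text \<open>
  If \<open>x > 0\<close>, a small \<open>\<epsilon>\<close> does not spoil the sign; if \<open>x = 0\<close>, the sign of \<open>y\<close> takes over.
\<close>
lemma lexpos_merge:
  assumes "lexpos (xs @ x # y # ys)"
  shows "\<forall>\<^sub>F \<epsilon> in at_right 0. lexpos (xs @ (x + \<epsilon> * y) # ys)"
proof -
  consider "lexpos xs" | "\<forall>z\<in>set xs. z = 0" "x > 0" | "\<forall>z\<in>set xs. z = 0" "x = 0" "y > 0"
    | "\<forall>z\<in>set xs. z = 0" "x = 0" "y = 0" "lexpos ys"
    using assms unfolding lexpos_append by auto
  then show ?thesis
  proof cases
    case 2
    have "((\<lambda>\<epsilon>. x + \<epsilon> * y) \<longlongrightarrow> x + 0 * y) (at_right 0)" by (intro tendsto_intros)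
    from order_tendstoD(1)[OF this, of 0] 2(2) have "\<forall>\<^sub>F \<epsilon> in at_right 0. x + \<epsilon> * y > 0" by simp
    then show ?thesis by eventually_elim (use 2 in \<open>simp add: lexpos_append\<close>)
  next
    case 3
    have "\<forall>\<^sub>F \<epsilon> in at_right 0. \<epsilon> > (0 :: real)" by (rule eventually_at_right_less)
    then show ?thesis by eventually_elim (use 3 in \<open>simp add: lexpos_append\<close>)
  qed (simp_all add: lexpos_append)
qed

text \<open>
  For small \<open>t > 0\<close> the lowest power dominates; the starting exponent \<open>e\<close> is general
  because removing a leading zero shifts it.
\<close>
lemma lexpos_eventually_positive:
  "lexpos xs \<Longrightarrow> \<forall>\<^sub>F t in at_right 0. (\<Sum>k<length xs. t ^ (e + k) * xs ! k) > 0"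
proof (induction xs arbitrary: e)
  case (Cons x xs)
  have split: "(\<Sum>k<length (x # xs). t ^ (e + k) * (x # xs) ! k)
      = t ^ e * x + (\<Sum>k<length xs. t ^ (Suc e + k) * xs ! k)" for t :: real
    by (simp add: sum.lessThan_Suc_shift del: sum.lessThan_Suc)
  show ?case
  proof (cases "x > 0")
    case True
    have "((\<lambda>t. x + t * (\<Sum>k<length xs. t ^ k * xs ! k))
        \<longlongrightarrow> x + 0 * (\<Sum>k<length xs. 0 ^ k * xs ! k)) (at_right 0)"
      by (intro tendsto_intros)
    from order_tendstoD(1)[OF this, of 0] True
    have "\<forall>\<^sub>F t in at_right 0. x + t * (\<Sum>k<length xs. t ^ k * xs ! k) > 0" by simp
    moreover have "\<forall>\<^sub>F t in at_right 0. t > (0 :: real)" by (rule eventually_at_right_less)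
    ultimately show ?thesis
    proof eventually_elim
      case (elim t)
      have "(\<Sum>k<length (x # xs). t ^ (e + k) * (x # xs) ! k)
          = t ^ e * (x + t * (\<Sum>k<length xs. t ^ k * xs ! k))"
        unfolding split by (simp add: sum_distrib_left distrib_left power_add mult_ac)
      then show ?case using elim by simp
    qed
  next
    case False
    then have "x = 0" "lexpos xs" using Cons.prems by auto
    then show ?thesis using Cons.IH[of "Suc e"] unfolding split by simp
  qed
qed simp

section \<open>Normalising a signed flag\<close>

text \<open>
  A pair \<open>(s, v)\<close> stands for a term \<open>t ^ k * v\<close> of an arc with \<open>s = (-1) ^ k\<close>.  The conditions say that the arc
  enters \<open>{x. l \<bullet> x > 0}\<close> for \<open>t < 0\<close> if \<open>l \<in> L1\<close>, and for \<open>t > 0\<close> if \<open>l \<in> L2\<close>.  Recording only the parity of the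
  exponents is what allows terms to be removed and merged.
\<close>
definition signed_flag :: "(real ^ 'n) set \<Rightarrow> (real ^ 'n) set \<Rightarrow> (real \<times> (real ^ 'n)) list \<Rightarrow> bool" where
  "signed_flag L1 L2 xs \<longleftrightarrow> fst ` set xs \<subseteq> {1, -1} \<and>
    (\<forall>l\<in>L1. lexpos (map (\<lambda>x. fst x * (l \<bullet> snd x)) xs)) \<and>
    (\<forall>l\<in>L2. lexpos (map (\<lambda>x. l \<bullet> snd x) xs))"

text \<open>
  A functional that vanishes on the predecessors also vanishes on \<open>v\<close>, so \<open>v\<close> never decides a sign.
\<close>
lemma signed_flag_drop:
  assumes flag: "signed_flag L1 L2 (xs @ (s, v) # ys)" and v: "v \<in> span (snd ` set xs)"
  shows "signed_flag L1 L2 (xs @ ys)"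
proof -
  have ortho: "l \<bullet> v = 0" if "\<forall>x\<in>set xs. l \<bullet> snd x = 0" for l
  proof -
    have "span (snd ` set xs) \<subseteq> {x. l \<bullet> x = 0}"
      using that by (intro span_minimal subspace_hyperplane) auto
    then show ?thesis using v by auto
  qed
  have nz: "fst x \<noteq> 0" if "x \<in> set xs" for x
    using flag that by (force simp: signed_flag_def)
  show ?thesis unfolding signed_flag_def
  proof (intro conjI ballI)
    fix l assume "l \<in> L1"
    then have "lexpos (map (\<lambda>x. fst x * (l \<bullet> snd x)) (xs @ (s, v) # ys))"
      using flag by (simp only: signed_flag_def)
    then show "lexpos (map (\<lambda>x. fst x * (l \<bullet> snd x)) (xs @ ys))"
      using ortho[of l] nz by (auto simp: lexpos_append)
  next
    fix l assume "l \<in> L2"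
    then have "lexpos (map (\<lambda>x. l \<bullet> snd x) (xs @ (s, v) # ys))"
      using flag by (simp only: signed_flag_def)
    then show "lexpos (map (\<lambda>x. l \<bullet> snd x) (xs @ ys))"
      using ortho[of l] by (auto simp: lexpos_append)
  qed (use flag in \<open>auto simp: signed_flag_def\<close>)
qed

lemma signed_flag_merge:
  assumes flag: "signed_flag L1 L2 (xs @ (s, u) # (s, w) # ys)" and "finite L1" "finite L2"
  shows "\<exists>v. signed_flag L1 L2 (xs @ (s, v) # ys)"
proof -
  have "\<forall>\<^sub>F \<epsilon> in at_right 0. \<forall>l\<in>L1.
      lexpos (map (\<lambda>x. fst x * (l \<bullet> snd x)) (xs @ (s, u + \<epsilon> *\<^sub>R w) # ys))"
  proof (intro eventually_ball_finite ballI \<open>finite L1\<close>)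
    fix l assume "l \<in> L1"
    then have "lexpos (map (\<lambda>x. fst x * (l \<bullet> snd x)) (xs @ (s, u) # (s, w) # ys))"
      using flag by (simp only: signed_flag_def)
    then have "lexpos (map (\<lambda>x. fst x * (l \<bullet> snd x)) xs @ (s * (l \<bullet> u)) # (s * (l \<bullet> w))
        # map (\<lambda>x. fst x * (l \<bullet> snd x)) ys)" by simp
    from lexpos_merge[OF this] show "\<forall>\<^sub>F \<epsilon> in at_right 0.
        lexpos (map (\<lambda>x. fst x * (l \<bullet> snd x)) (xs @ (s, u + \<epsilon> *\<^sub>R w) # ys))"
      by (rule eventually_mono) (simp add: inner_add_right distrib_left mult_ac)
  qed
  moreover have "\<forall>\<^sub>F \<epsilon> in at_right 0. \<forall>l\<in>L2.
      lexpos (map (\<lambda>x. l \<bullet> snd x) (xs @ (s, u + \<epsilon> *\<^sub>R w) # ys))"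
  proof (intro eventually_ball_finite ballI \<open>finite L2\<close>)
    fix l assume "l \<in> L2"
    then have "lexpos (map (\<lambda>x. l \<bullet> snd x) (xs @ (s, u) # (s, w) # ys))"
      using flag by (simp only: signed_flag_def)
    then have "lexpos (map (\<lambda>x. l \<bullet> snd x) xs @ (l \<bullet> u) # (l \<bullet> w)
        # map (\<lambda>x. l \<bullet> snd x) ys)" by simp
    from lexpos_merge[OF this] show "\<forall>\<^sub>F \<epsilon> in at_right 0.
        lexpos (map (\<lambda>x. l \<bullet> snd x) (xs @ (s, u + \<epsilon> *\<^sub>R w) # ys))"
      by (rule eventually_mono) (simp add: inner_add_right)
  qed
  ultimately have "\<forall>\<^sub>F \<epsilon> :: real in at_right 0. signed_flag L1 L2 (xs @ (s, u + \<epsilon> *\<^sub>R w) # ys)"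
  proof eventually_elim
    case (elim \<epsilon>)
    then show ?case using flag unfolding signed_flag_def by auto
  qed
  then show ?thesis using eventually_happens'[OF trivial_limit_at_right_real] by blast
qed

text \<open>
  Both moves shorten the list, so they come to an end.
\<close>
lemma signed_flag_normal_form:
  assumes "signed_flag L1 L2 xs" "finite L1" "finite L2"
  shows "\<exists>ys. signed_flag L1 L2 ys \<and>
    (\<forall>as s v bs. ys = as @ (s, v) # bs \<longrightarrow> v \<notin> span (snd ` set as)) \<and>
    (\<forall>as s u w bs. ys \<noteq> as @ (s, u) # (s, w) # bs)"
  using assms(1)
proof (induction xs rule: length_induct)
  case (1 xs)
  consider (dep) as s v bs where "xs = as @ (s, v) # bs" "v \<in> span (snd ` set as)"
    | (same) as s u w bs where "xs = as @ (s, u) # (s, w) # bs"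
    | (normal) "\<forall>as s v bs. xs = as @ (s, v) # bs \<longrightarrow> v \<notin> span (snd ` set as)"
        "\<forall>as s u w bs. xs \<noteq> as @ (s, u) # (s, w) # bs"
    by blast
  then show ?case
  proof cases
    case dep
    have flag: "signed_flag L1 L2 (as @ bs)"
      using 1(2) dep(2) unfolding dep(1) by (rule signed_flag_drop)
    have shorter: "length (as @ bs) < length xs" by (simp add: dep(1))
    show ?thesis by (rule 1(1)[rule_format, OF shorter flag])
  next
    case same
    obtain v where flag: "signed_flag L1 L2 (as @ (s, v) # bs)"
      using signed_flag_merge[OF 1(2)[unfolded same] assms(2,3)] by blast
    have shorter: "length (as @ (s, v) # bs) < length xs" by (simp add: same)
    show ?thesis by (rule 1(1)[rule_format, OF shorter flag])
  next
    case normal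
    with 1(2) show ?thesis by (intro exI[of _ xs] conjI)
  qed
qed

lemma flag_independent:
  assumes "\<And>as v bs. vs = as @ v # bs \<Longrightarrow> v \<notin> span (set as)"
  shows "independent (set vs)" "distinct vs"
proof -
  have "independent (set vs) \<and> distinct vs"
    using assms
  proof (induction vs rule: rev_induct)
    case (snoc v vs)
    have "independent (set vs) \<and> distinct vs"
    proof (rule snoc.IH)
      fix as w bs assume "vs = as @ w # bs"
      then show "w \<notin> span (set as)" using snoc.prems[of as w "bs @ [v]"] by simp
    qed
    moreover have v: "v \<notin> span (set vs)" using snoc.prems[of vs v "[]"] by simp
    moreover have "v \<notin> set vs" using v span_base by blast
    ultimately show ?case by (simp add: independent_insert)
  qed (simp add: independent_empty)
  then show "independent (set vs)" "distinct vs" by auto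
qed

lemma alternating_signs:
  assumes "fst ` set xs \<subseteq> {1, -1 :: real}"
    and "\<And>as s u w bs. xs \<noteq> as @ (s, u) # (s, w) # bs"
    and "xs \<noteq> []" "fst (hd xs) = (-1) ^ e" "k < length xs"
  shows "fst (xs ! k) = (-1) ^ (e + k)"
  using \<open>k < length xs\<close>
proof (induction k)
  case 0
  then show ?case using assms(3,4) by (simp add: hd_conv_nth)
next
  case (Suc k)
  have "xs = take k xs @ xs ! k # xs ! Suc k # drop (Suc (Suc k)) xs"
    using Suc.prems by (metis Cons_nth_drop_Suc Suc_lessD append_take_drop_id)
  then have "fst (xs ! k) \<noteq> fst (xs ! Suc k)"
    using assms(2)[of "take k xs" "fst (xs ! k)" "snd (xs ! k)" "snd (xs ! Suc k)"] by (metis prod.collapse)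
  moreover have "fst (xs ! k) \<in> {1, -1}" "fst (xs ! Suc k) \<in> {1, -1}"
    using assms(1) Suc.prems by (auto dest: nth_mem Suc_lessD)
  moreover have "fst (xs ! k) = (-1) ^ (e + k)" using Suc by simp
  ultimately show ?case by auto
qed

text \<open>
  Passing from \<open>t\<close> to \<open>- t\<close> multiplies the \<open>k\<close>-th term by \<open>(-1) ^ (e + k)\<close>, which is the recorded sign.
\<close>
lemma signed_flag_power_sum:
  fixes \<gamma> :: "real \<Rightarrow> real ^ 'n"
  assumes flag: "signed_flag L1 L2 ys" and "finite L1" "finite L2"
    and signs: "\<forall>k<length ys. fst (ys ! k) = (-1) ^ (e + k)"
    and \<gamma>: "\<And>t. \<gamma> t = (\<Sum>k<length ys. t ^ (e + k) *\<^sub>R snd (ys ! k))"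
  shows "\<forall>\<^sub>F t in at_right 0. \<forall>l\<in>L1. l \<bullet> \<gamma> (- t) > 0"
    and "\<forall>\<^sub>F t in at_right 0. \<forall>l\<in>L2. l \<bullet> \<gamma> t > 0"
proof -
  show "\<forall>\<^sub>F t in at_right 0. \<forall>l\<in>L1. l \<bullet> \<gamma> (- t) > 0"
  proof (intro eventually_ball_finite ballI \<open>finite L1\<close>)
    fix l assume "l \<in> L1"
    then have "lexpos (map (\<lambda>x. fst x * (l \<bullet> snd x)) ys)"
      using flag by (simp only: signed_flag_def)
    from lexpos_eventually_positive[OF this, of e]
    show "\<forall>\<^sub>F t in at_right 0. l \<bullet> \<gamma> (- t) > 0"
    proof eventually_elim
      case (elim t)
      have "l \<bullet> \<gamma> (- t) = (\<Sum>k<length ys. (- t) ^ (e + k) * (l \<bullet> snd (ys ! k)))"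
        by (simp add: \<gamma> inner_sum_right)
      also have "\<dots> = (\<Sum>k<length ys. t ^ (e + k) * (fst (ys ! k) * (l \<bullet> snd (ys ! k))))"
      proof (intro sum.cong refl)
        fix k assume "k \<in> {..<length ys}"
        then have "(- t) ^ (e + k) = t ^ (e + k) * fst (ys ! k)"
          using power_minus[of t "e + k"] by (simp add: signs mult.commute)
        then show "(- t) ^ (e + k) * (l \<bullet> snd (ys ! k))
            = t ^ (e + k) * (fst (ys ! k) * (l \<bullet> snd (ys ! k)))" by simp
      qed
      finally show ?case using elim by simp
    qed
  qed
  show "\<forall>\<^sub>F t in at_right 0. \<forall>l\<in>L2. l \<bullet> \<gamma> t > 0"
  proof (intro eventually_ball_finite ballI \<open>finite L2\<close>)
    fix l assume "l \<in> L2"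
    then have "lexpos (map (\<lambda>x. l \<bullet> snd x) ys)"
      using flag by (simp only: signed_flag_def)
    from lexpos_eventually_positive[OF this, of e]
    show "\<forall>\<^sub>F t in at_right 0. l \<bullet> \<gamma> t > 0"
      by eventually_elim (simp add: \<gamma> inner_sum_right)
  qed
qed

section \<open>Polyhedra near one of their points\<close>

text \<open>
  The vectors in \<open>L\<close> are the inner normals of the half-spaces that have \<open>0\<close> on their boundary; the
  remaining inequalities are strict at \<open>0\<close> and hence hold nearby.
\<close>
lemma polyhedron_interior_near_0:
  fixes K :: "'a::euclidean_space set"
  assumes "polyhedron K" "0 \<in> K"
  shows "\<exists>L r. finite L \<and> r > 0 \<and> (\<forall>x. norm x < r \<longrightarrow> (x \<in> interior K \<longleftrightarrow> (\<forall>l\<in>L. l \<bullet> x > 0)))"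
proof -
  obtain F where F: "finite F" "K = \<Inter>F" "\<forall>h\<in>F. \<exists>a b. a \<noteq> 0 \<and> h = {x. a \<bullet> x \<le> b}"
    using assms(1) unfolding polyhedron_def by blast
  from F(3) obtain a b where ab: "\<And>h. h \<in> F \<Longrightarrow> a h \<noteq> 0" "\<And>h. h \<in> F \<Longrightarrow> h = {x. a h \<bullet> x \<le> b h}"
    by metis
  have b_nonneg: "b h \<ge> 0" if "h \<in> F" for h
    using assms(2) ab(2)[OF that] that unfolding F(2) by (metis InterD inner_zero_right mem_Collect_eq)
  have int: "interior (\<Inter>G) = \<Inter>(interior ` G)" if "finite G" for G :: "'a set set"
    using that by (induction G rule: finite_induct) auto
  have "interior h = {x. a h \<bullet> x < b h}" if "h \<in> F" for h
    using ab(2)[OF that] ab(1)[OF that] interior_halfspace_le by metis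
  then have interior_K: "x \<in> interior K \<longleftrightarrow> (\<forall>h\<in>F. a h \<bullet> x < b h)" for x
    unfolding F(2) int[OF F(1)] by auto
  have "\<forall>\<^sub>F x in nhds 0. \<forall>h\<in>F. b h > 0 \<longrightarrow> a h \<bullet> x < b h"
  proof (intro eventually_ball_finite F(1) ballI)
    fix h assume "h \<in> F"
    have "((\<lambda>x. a h \<bullet> x) \<longlongrightarrow> a h \<bullet> 0) (nhds 0)" by (intro tendsto_intros filterlim_ident)
    from order_tendstoD(2)[OF this, of "b h"]
    show "\<forall>\<^sub>F x in nhds 0. b h > 0 \<longrightarrow> a h \<bullet> x < b h" by (cases "b h > 0") simp_all
  qed
  then obtain r where r: "r > 0" "\<And>x h. norm x < r \<Longrightarrow> h \<in> F \<Longrightarrow> b h > 0 \<Longrightarrow> a h \<bullet> x < b h"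
    unfolding eventually_nhds_metric by auto
  define L where "L = (\<lambda>h. - a h) ` {h \<in> F. b h = 0}"
  have "x \<in> interior K \<longleftrightarrow> (\<forall>l\<in>L. l \<bullet> x > 0)" if "norm x < r" for x
  proof -
    have "a h \<bullet> x < b h \<longleftrightarrow> (b h = 0 \<longrightarrow> - a h \<bullet> x > 0)" if "h \<in> F" for h
      using r(2)[OF \<open>norm x < r\<close> that] b_nonneg[OF that] by (cases "b h = 0") auto
    then show ?thesis unfolding interior_K L_def by auto
  qed
  moreover have "finite L" using F(1) by (simp add: L_def)
  ultimately show ?thesis using r(1) by blast
qed

section \<open>Coordinates adapted to independent vectors\<close>

text \<open>
  The vectors are extended to a basis, whose elements become the columns in the order
  prescribed by \<open>pos\<close>.  Positions are numbered from 1 and list entries from 0.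
\<close>
lemma independent_list_columns:
  fixes vs :: "(real ^ 'n) list" and pos :: "'n \<Rightarrow> nat"
  assumes "independent (set vs)" "distinct vs" and pos: "bij_betw pos UNIV {1..CARD('n)}"
  shows "length vs \<le> CARD('n)"
    and "\<exists>B. invertible B \<and> (\<forall>i. pos i \<le> length vs \<longrightarrow> column i B = vs ! (pos i - 1))"
proof -
  obtain S where S: "set vs \<subseteq> S" "independent S" "UNIV \<subseteq> span S"
    by (rule maximal_independent_subset_extend[OF subset_UNIV assms(1)])
  have "finite S" using S(2) by (rule independent_imp_finite)
  have "span S = UNIV" using S(3) by blast
  then have "dim (UNIV :: (real ^ 'n) set) = card S" using S(2) by (intro dim_eq_card) simp_all
  then have "card S = CARD('n)" by simp
  obtain ws where ws: "set ws = S - set vs" "distinct ws"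
    using \<open>finite S\<close> finite_distinct_list[of "S - set vs"] by auto
  define us where "us = vs @ ws"
  have us: "set us = S" "distinct us" using ws S(1) assms(2) by (auto simp: us_def)
  then have len: "length us = CARD('n)" using \<open>card S = CARD('n)\<close> distinct_card by metis
  then show "length vs \<le> CARD('n)" by (simp add: us_def)
  define B :: "real ^ 'n ^ 'n" where "B = (\<chi> r c. us ! (pos c - 1) $ r)"
  have col: "column i B = us ! (pos i - 1)" for i
    by (simp add: column_def B_def vec_eq_iff)
  have "S \<subseteq> columns B"
  proof
    fix u assume "u \<in> S"
    then obtain k where "k < CARD('n)" "u = us ! k" using us(1) len by (metis in_set_conv_nth)
    moreover then have "Suc k \<in> pos ` UNIV" using bij_betw_imp_surj_on[OF pos] by auto
    then obtain i where "pos i = Suc k" by force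
    ultimately have "u = column i B" by (simp add: col)
    then show "u \<in> columns B" by (auto simp: columns_def)
  qed
  then have "span (columns B) = UNIV" using S(3) span_mono by blast
  then have "invertible B"
    unfolding invertible_right_inverse matrix_right_invertible_span_columns span_vec_eq .
  moreover have "column i B = vs ! (pos i - 1)" if "pos i \<le> length vs" for i
  proof -
    have "pos i \<in> {1..CARD('n)}" using bij_betwE[OF pos] by blast
    then show ?thesis using that by (auto simp: col us_def nth_append)
  qed
  ultimately show "\<exists>B. invertible B \<and> (\<forall>i. pos i \<le> length vs \<longrightarrow> column i B = vs ! (pos i - 1))"
    by blast
qed

lemma matrix_power_arc:
  fixes B :: "real ^ 'n ^ 'n"
  assumes pos: "bij_betw pos UNIV {1..CARD('n)}" and "length vs \<le> CARD('n)"
    and col: "\<And>i. pos i \<le> length vs \<Longrightarrow> column i B = vs ! (pos i - 1)"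
  shows "B *v power_arc pos e (length vs) t = (\<Sum>k<length vs. t ^ (e + k) *\<^sub>R vs ! k)"
proof -
  define h where "h j = (if j \<le> length vs then t ^ (e + j - 1) *\<^sub>R vs ! (j - 1) else 0)" for j
  have "B *v power_arc pos e (length vs) t = (\<Sum>i\<in>UNIV. h (pos i))"
    unfolding matrix_mult_sum h_def power_arc_def
    by (intro sum.cong) (auto simp: col scalar_mult_eq_scaleR)
  also have "\<dots> = (\<Sum>j\<in>{1..CARD('n)}. h j)" by (rule sum.reindex_bij_betw[OF pos])
  also have "\<dots> = (\<Sum>j\<in>{1..length vs}. h j)"
    using assms(2) by (intro sum.mono_neutral_right) (auto simp: h_def)
  also have "\<dots> = (\<Sum>k<length vs. h (Suc k))" by (simp add: sum.atLeast1_atMost_eq)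
  also have "\<dots> = (\<Sum>k<length vs. t ^ (e + k) *\<^sub>R vs ! k)"
    by (intro sum.cong) (auto simp: h_def)
  finally show ?thesis .
qed

section \<open>Nash arcs\<close>

text \<open>
  The given higher derivatives belong to an extension of \<open>\<alpha>\<close>; the graph and the derivatives are stated for
  that extension, which is the zeroth derivative \<open>D 0\<close>.
\<close>
lemma Nash_arc_derivatives:
  fixes \<alpha> :: "real \<Rightarrow> 'a::euclidean_space"
  assumes "Nash_arc \<alpha>"
  obtains I D where "{-1..1} \<subseteq> I" "\<And>t. \<bar>t\<bar> < 1 \<Longrightarrow> D 0 t = \<alpha> t"
    "\<And>k t. \<bar>t\<bar> < 1 \<Longrightarrow> (D k has_vector_derivative D (Suc k) t) (at t)"
    "semialgebraic {(t, D 0 t) | t. t \<in> I}"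
proof -
  obtain I g where I: "{-1..1} \<subseteq> I" and g: "\<And>t. t \<in> {-1..1} \<Longrightarrow> g t = \<alpha> t"
    and smooth: "C_infinity_on g I" and semialg: "semialgebraic {(t, g t) | t. t \<in> I}"
    using assms unfolding Nash_arc_def by blast
  obtain D where D0: "\<And>t. t \<in> I \<Longrightarrow> D 0 t = g t"
    and D: "\<And>k t. t \<in> I \<Longrightarrow> (D k has_vector_derivative D (Suc k) t) (at t)"
    using smooth unfolding C_infinity_on_def by blast
  have near: "t \<in> {-1..1}" "t \<in> I" if "\<bar>t\<bar> < 1" for t
  proof -
    show "t \<in> {-1..1}" using that by auto
    then show "t \<in> I" using I by blast
  qed
  have "{(t, D 0 t) | t. t \<in> I} = {(t, g t) | t. t \<in> I}" using D0 by force
  then show thesis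
    using near I g D0 D semialg by (intro that[of I D]) simp_all
qed

lemma Nash_arc_continuous_at_0:
  assumes "Nash_arc \<alpha>"
  shows "isCont \<alpha> 0"
proof -
  obtain D where D0: "\<And>t. \<bar>t\<bar> < 1 \<Longrightarrow> D 0 t = \<alpha> t"
    and D: "\<And>k t. \<bar>t\<bar> < 1 \<Longrightarrow> (D k has_vector_derivative D (Suc k) t) (at t)"
    using Nash_arc_derivatives[OF assms] by metis
  have "isCont (D 0) 0" by (rule has_vector_derivative_continuous[OF D]) simp
  moreover have "\<forall>\<^sub>F t in nhds 0. D 0 t = \<alpha> t"
    unfolding eventually_nhds_metric by (intro exI[of _ 1]) (simp add: D0)
  ultimately show ?thesis by (simp cong: isCont_cong)
qed

text \<open>
  The signed flag consists of the derivatives at \<open>0\<close>.  The factorials of Taylor's formula are left out, since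
  they do not affect signs, and finitely many derivatives suffice because no functional in \<open>L1\<close> or \<open>L2\<close> is
  flat along the arc.
\<close>
lemma Nash_arc_signed_flag:
  fixes \<alpha> :: "real \<Rightarrow> real ^ 'n"
  assumes "Nash_arc \<alpha>" "finite L1" "finite L2"
    and neg: "\<And>l. l \<in> L1 \<Longrightarrow> \<forall>\<^sub>F t in at_right 0. l \<bullet> \<alpha> (- t) > 0"
    and pos: "\<And>l. l \<in> L2 \<Longrightarrow> \<forall>\<^sub>F t in at_right 0. l \<bullet> \<alpha> t > 0"
  shows "\<exists>xs. signed_flag L1 L2 xs"
proof -
  obtain I D where I: "{-1..1} \<subseteq> I" and D0: "\<And>t. \<bar>t\<bar> < 1 \<Longrightarrow> D 0 t = \<alpha> t"
    and D: "\<And>k t. \<bar>t\<bar> < 1 \<Longrightarrow> (D k has_vector_derivative D (Suc k) t) (at t)"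
    and semialg: "semialgebraic {(t, D 0 t) | t. t \<in> I}"
    using Nash_arc_derivatives[OF assms(1)] by blast
  have small: "\<forall>\<^sub>F t in at_right 0. \<bar>t\<bar> < (1 :: real)"
    by (auto simp: eventually_at intro!: exI[of _ 1])
  have leading: "\<exists>m. l \<bullet> D m 0 \<noteq> 0 \<and> (\<forall>j<m. l \<bullet> D j 0 = 0) \<and>
      ((\<lambda>t. l \<bullet> D 0 t / t ^ m) \<longlongrightarrow> l \<bullet> D m 0 / fact m) (at 0)"
    if "\<exists>\<^sub>F t in at 0. l \<bullet> D 0 t \<noteq> 0" for l
  proof -
    have "real_polynomial_function (\<lambda>z :: real \<times> (real ^ 'n). l \<bullet> snd z)"
      by (intro real_polynomial_function.intros(1) bounded_linear_inner_right_comp bounded_linear_snd)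
    then obtain d where "param_poly d (\<lambda>t x. l \<bullet> x)"
      using real_polynomial_function_param_poly[of "\<lambda>z. l \<bullet> snd z"] by auto
    from semialgebraic_function_algebraic[OF semialg this]
    obtain R where "R \<noteq> 0" "\<forall>t\<in>I. eval2 R t (l \<bullet> D 0 t) = 0" by blast
    then have "eval2 R t (l \<bullet> D 0 t) = 0" if "\<bar>t\<bar> < 1" for t
      using I that by (simp add: subset_iff abs_less_iff)
    moreover note \<open>R \<noteq> 0\<close>
    moreover have "((\<lambda>t. l \<bullet> D k t) has_real_derivative l \<bullet> D (Suc k) t) (at t)"
      if "\<bar>t\<bar> < 1" for k t
      using bounded_linear.has_vector_derivative[OF bounded_linear_inner_right D[OF that]]
      by (simp add: has_real_derivative_iff_has_vector_derivative)
    ultimately show ?thesis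
      using algebraic_leading_term[of 1 "\<lambda>k t. l \<bullet> D k t" R] that by simp
  qed
  have lead1: "\<exists>m. (-1) ^ m * (l \<bullet> D m 0) > 0 \<and> (\<forall>j<m. l \<bullet> D j 0 = 0)" if "l \<in> L1" for l
  proof -
    have *: "\<forall>\<^sub>F t in at_right 0. l \<bullet> D 0 (- t) > 0"
      using neg[OF that] small by eventually_elim (simp add: D0)
    have "\<forall>\<^sub>F t in at_left 0. l \<bullet> D 0 t \<noteq> 0"
      unfolding at_left_minus[of "0 :: real"] eventually_filtermap
      using * by (simp, elim eventually_mono) simp
    then have "\<exists>\<^sub>F t in at_left 0. l \<bullet> D 0 t \<noteq> 0"
      by (rule eventually_frequently[rotated]) simp
    then have "\<exists>\<^sub>F t in at 0. l \<bullet> D 0 t \<noteq> 0"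
      unfolding frequently_def eventually_at_split by blast
    from leading[OF this] obtain m where m: "l \<bullet> D m 0 \<noteq> 0" "\<forall>j<m. l \<bullet> D j 0 = 0"
      "((\<lambda>t. l \<bullet> D 0 t / t ^ m) \<longlongrightarrow> l \<bullet> D m 0 / fact m) (at 0)" by blast
    have "(-1) ^ m * (l \<bullet> D m 0 / fact m) > 0"
      using leading_coefficient_signs(2)[OF m(3) _ *] m(1) by simp
    then have "(-1) ^ m * (l \<bullet> D m 0) > 0" by (simp add: zero_less_divide_iff)
    with m(2) show ?thesis by blast
  qed
  have lead2: "\<exists>m. l \<bullet> D m 0 > 0 \<and> (\<forall>j<m. l \<bullet> D j 0 = 0)" if "l \<in> L2" for l
  proof -
    have *: "\<forall>\<^sub>F t in at_right 0. l \<bullet> D 0 t > 0"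
      using pos[OF that] small by eventually_elim (simp add: D0)
    have "\<exists>\<^sub>F t in at_right 0. l \<bullet> D 0 t \<noteq> 0"
      by (rule eventually_frequently) (use * in \<open>auto elim: eventually_mono\<close>)
    then have "\<exists>\<^sub>F t in at 0. l \<bullet> D 0 t \<noteq> 0"
      unfolding frequently_def eventually_at_split by blast
    from leading[OF this] obtain m where m: "l \<bullet> D m 0 \<noteq> 0" "\<forall>j<m. l \<bullet> D j 0 = 0"
      "((\<lambda>t. l \<bullet> D 0 t / t ^ m) \<longlongrightarrow> l \<bullet> D m 0 / fact m) (at 0)" by blast
    have "l \<bullet> D m 0 / fact m > 0"
      using leading_coefficient_signs(1)[OF m(3) _ *] m(1) by simp
    then have "l \<bullet> D m 0 > 0" by (simp add: zero_less_divide_iff)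
    with m(2) show ?thesis by blast
  qed
  obtain m1 where m1: "\<And>l. l \<in> L1 \<Longrightarrow> (-1) ^ m1 l * (l \<bullet> D (m1 l) 0) > 0"
    "\<And>l j. l \<in> L1 \<Longrightarrow> j < m1 l \<Longrightarrow> l \<bullet> D j 0 = 0" using lead1 by metis
  obtain m2 where m2: "\<And>l. l \<in> L2 \<Longrightarrow> l \<bullet> D (m2 l) 0 > 0"
    "\<And>l j. l \<in> L2 \<Longrightarrow> j < m2 l \<Longrightarrow> l \<bullet> D j 0 = 0" using lead2 by metis
  have "finite (m1 ` L1 \<union> m2 ` L2)" using assms(2,3) by simp
  then obtain N where N: "\<And>l. l \<in> L1 \<Longrightarrow> m1 l < N" "\<And>l. l \<in> L2 \<Longrightarrow> m2 l < N"
    unfolding finite_nat_set_iff_bounded by blast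
  have "signed_flag L1 L2 (map (\<lambda>k. ((-1) ^ k, D k 0)) [0..<N])"
    unfolding signed_flag_def
  proof (intro conjI ballI)
    show "fst ` set (map (\<lambda>k. ((-1 :: real) ^ k, D k 0)) [0..<N]) \<subseteq> {1, -1}"
      by (auto simp: minus_one_power_iff)
  next
    fix l assume "l \<in> L1"
    then have "lexpos (map (\<lambda>k. (-1) ^ k * (l \<bullet> D k 0)) [0..<N])"
      using m1 N(1) by (intro lexpos_map_upt[of "m1 l"]) auto
    then show "lexpos (map (\<lambda>x. fst x * (l \<bullet> snd x)) (map (\<lambda>k. ((-1) ^ k, D k 0)) [0..<N]))"
      by (simp add: comp_def)
  next
    fix l assume "l \<in> L2"
    then have "lexpos (map (\<lambda>k. l \<bullet> D k 0) [0..<N])"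
      using m2 N(2) by (intro lexpos_map_upt[of "m2 l"]) auto
    then show "lexpos (map (\<lambda>x. l \<bullet> snd x) (map (\<lambda>k. ((-1) ^ k, D k 0)) [0..<N]))"
      by (simp add: comp_def)
  qed
  then show ?thesis by blast
qed

section \<open>From Nash arcs to power arcs\<close>

theorem theorem4p2:
  fixes K1 K2 :: "(real ^ 'n) set"
    and \<alpha> :: "real \<Rightarrow> real ^ 'n"
    and pos :: "'n \<Rightarrow> nat"
  assumes "bij_betw pos UNIV {1..CARD('n)}"
    and "polyhedron K1" and "polyhedron K2"
    and "aff_dim K1 = int CARD('n)" and "aff_dim K2 = int CARD('n)"
    and "0 \<in> K1 \<inter> K2"
    and "interior K1 \<inter> interior K2 = {}"
    and "Nash_arc \<alpha>"
    and "\<alpha> ` {-1..1} \<subseteq> K1 \<union> K2"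
    and "\<alpha> 0 = 0"
    and "\<alpha> ` {-1..<0} \<subseteq> interior K1"
    and "\<alpha> ` {0<..1} \<subseteq> interior K2"
  shows "\<exists>e\<in>{1, 2}. \<exists>d. e \<le> d \<and> d \<le> CARD('n) \<and>
    (\<exists>\<epsilon>>0. \<exists>\<phi>. invertible_affine \<phi> \<and> \<phi> 0 = 0 \<and>
      (let \<beta> = power_arc pos e d in
        \<beta> ` {-\<epsilon>..\<epsilon>} \<subseteq> \<phi> ` K1 \<union> \<phi> ` K2 \<and>
        \<beta> 0 = 0 \<and>
        \<beta> ` {-\<epsilon>..<0} \<subseteq> interior (\<phi> ` K1) \<and>
        \<beta> ` {0<..\<epsilon>} \<subseteq> interior (\<phi> ` K2)))"
proof -
  obtain L1 r1 where L1: "finite L1" "r1 > 0"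
    "\<And>x. norm x < r1 \<Longrightarrow> x \<in> interior K1 \<longleftrightarrow> (\<forall>l\<in>L1. l \<bullet> x > 0)"
    using polyhedron_interior_near_0[of K1] assms(2,6) by blast
  obtain L2 r2 where L2: "finite L2" "r2 > 0"
    "\<And>x. norm x < r2 \<Longrightarrow> x \<in> interior K2 \<longleftrightarrow> (\<forall>l\<in>L2. l \<bullet> x > 0)"
    using polyhedron_interior_near_0[of K2] assms(3,6) by blast
  define r where "r = min r1 r2"
  have r: "r > 0" using L1(2) L2(2) by (simp add: r_def)
  have small: "\<forall>\<^sub>F t in at_right 0. norm (c (s * t)) < r"
    if "isCont c 0" "c 0 = 0" for c :: "real \<Rightarrow> real ^ 'n" and s
  proof -
    have "((\<lambda>t. c (s * t)) \<longlongrightarrow> c 0) (at_right 0)"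
      by (intro isCont_tendsto_compose[OF that(1)]) (auto intro!: tendsto_eq_intros)
    then have "((\<lambda>t. norm (c (s * t))) \<longlongrightarrow> 0) (at_right 0)"
      using that(2) by (simp add: tendsto_norm_zero)
    then show ?thesis using r by (rule order_tendstoD(2))
  qed
  have unit: "\<forall>\<^sub>F t in at_right 0. 0 < t \<and> t \<le> (1 :: real)"
    unfolding eventually_at_right_field by (intro exI[of _ 1]) auto
  have \<alpha>_cont: "isCont \<alpha> 0" using assms(8) by (rule Nash_arc_continuous_at_0)
  have "\<forall>\<^sub>F t in at_right 0. l \<bullet> \<alpha> (- t) > 0" if "l \<in> L1" for l
    using small[OF \<alpha>_cont assms(10), of "-1"] unit
  proof eventually_elim
    case (elim t)
    then have "\<alpha> (- t) \<in> interior K1" using assms(11) by auto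
    then show ?case using L1(3)[of "\<alpha> (- t)"] elim that by (auto simp: r_def)
  qed
  moreover have "\<forall>\<^sub>F t in at_right 0. l \<bullet> \<alpha> t > 0" if "l \<in> L2" for l
    using small[OF \<alpha>_cont assms(10), of 1] unit
  proof eventually_elim
    case (elim t)
    then have "\<alpha> t \<in> interior K2" using assms(12) by auto
    then show ?case using L2(3)[of "\<alpha> t"] elim that by (auto simp: r_def)
  qed
  ultimately obtain xs where "signed_flag L1 L2 xs"
    using Nash_arc_signed_flag[OF assms(8) L1(1) L2(1)] by blast
  then obtain ys where ys: "signed_flag L1 L2 ys"
    "\<And>as s v bs. ys = as @ (s, v) # bs \<Longrightarrow> v \<notin> span (snd ` set as)"
    "\<And>as s u w bs. ys \<noteq> as @ (s, u) # (s, w) # bs"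
    using signed_flag_normal_form[OF _ L1(1) L2(1)] by blast
  have sgn: "fst ` set ys \<subseteq> {1, -1}" using ys(1) by (simp add: signed_flag_def)
  \<comment> \<open>A direction positive on all functionals would lead from \<open>0\<close> into both interiors.\<close>
  have no_common_direction: False
    if "\<And>l. l \<in> L1 \<union> L2 \<Longrightarrow> l \<bullet> v > 0" for v
  proof -
    have "isCont (\<lambda>t. t *\<^sub>R v) 0" by (intro continuous_intros)
    from small[of "\<lambda>t. t *\<^sub>R v" 1, OF this scaleR_zero_left] eventually_at_right_less[of "0 :: real"]
    have "\<forall>\<^sub>F t in at_right 0. t *\<^sub>R v \<in> interior K1 \<inter> interior K2"
    proof eventually_elim
      case (elim t)
      then show ?case using that L1(3)[of "t *\<^sub>R v"] L2(3)[of "t *\<^sub>R v"] by (auto simp: r_def)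
    qed
    then have "\<exists>t. t *\<^sub>R v \<in> interior K1 \<inter> interior K2"
      by (intro eventually_happens'[OF trivial_limit_at_right_real])
    then show False using assms(7) by blast
  qed
  have "ys \<noteq> []"
  proof
    assume "ys = []"
    then have "L1 = {}" "L2 = {}" using ys(1) by (auto simp: signed_flag_def)
    then show False using no_common_direction by blast
  qed
  define e :: nat where "e = (if fst (hd ys) = -1 then 1 else 2)"
  have hd_sgn: "fst (hd ys) = (-1) ^ e"
    using sgn hd_in_set[OF \<open>ys \<noteq> []\<close>] by (auto simp: e_def)
  \<comment> \<open>A single vector of even sign is a common direction.\<close>
  have "e \<le> length ys"
  proof (rule ccontr)
    assume "\<not> e \<le> length ys"
    moreover have "1 \<le> length ys" using \<open>ys \<noteq> []\<close> by (simp add: Suc_le_eq)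
    ultimately have "e = 2" "length ys = 1" by (simp_all add: e_def split: if_splits)
    then obtain v where "ys = [(1, v)]" using hd_sgn by (cases ys) auto
    then show False using ys(1) no_common_direction[of v] by (auto simp: signed_flag_def)
  qed
  define vs where "vs = map snd ys"
  have len: "length vs = length ys" by (simp add: vs_def)
  have fresh: "v \<notin> span (set as)" if vs_split: "vs = as @ v # bs" for as v bs
  proof -
    obtain as' y bs' where "ys = as' @ y # bs'" "as = map snd as'" "v = snd y"
      using vs_split unfolding vs_def map_eq_append_conv Cons_eq_map_conv by blast
    then show ?thesis using ys(2)[of as' "fst y" "snd y" bs'] by simp
  qed
  have indep: "independent (set vs)" "distinct vs"
    by (rule flag_independent, erule fresh)+
  have d_le: "length vs \<le> CARD('n)" by (rule independent_list_columns(1)[OF indep assms(1)])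
  obtain B :: "real ^ 'n ^ 'n" where B: "invertible B"
    "\<And>i. pos i \<le> length vs \<Longrightarrow> column i B = vs ! (pos i - 1)"
    using independent_list_columns(2)[OF indep assms(1)] by blast
  define \<beta> where "\<beta> = power_arc pos e (length vs)"
  \<comment> \<open>The power arc in the original coordinates.\<close>
  define \<gamma> where "\<gamma> t = (\<Sum>k<length vs. t ^ (e + k) *\<^sub>R vs ! k)" for t
  have B\<beta>: "B *v \<beta> t = \<gamma> t" for t
    unfolding \<beta>_def \<gamma>_def by (rule matrix_power_arc[OF assms(1) d_le B(2)])
  have e: "e \<in> {1, 2}" by (simp add: e_def)
  then have \<gamma>0: "\<gamma> 0 = 0" by (auto simp: \<gamma>_def)
  have \<gamma>_cont: "isCont \<gamma> 0" unfolding \<gamma>_def by (intro continuous_intros)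
  have \<gamma>_ys: "\<gamma> t = (\<Sum>k<length ys. t ^ (e + k) *\<^sub>R snd (ys ! k))" for t
    by (simp add: \<gamma>_def vs_def)
  have signs: "\<forall>k<length ys. fst (ys ! k) = (-1) ^ (e + k)"
    using alternating_signs[OF sgn ys(3) \<open>ys \<noteq> []\<close> hd_sgn] by blast
  have "\<forall>\<^sub>F t in at_right 0. \<gamma> (- t) \<in> interior K1 \<and> \<gamma> t \<in> interior K2"
    using small[OF \<gamma>_cont \<gamma>0, of 1] small[OF \<gamma>_cont \<gamma>0, of "-1"]
      signed_flag_power_sum[OF ys(1) L1(1) L2(1) signs \<gamma>_ys]
  proof eventually_elim
    case (elim t)
    then show ?case using L1(3)[of "\<gamma> (- t)"] L2(3)[of "\<gamma> t"] by (simp add: r_def)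
  qed
  then obtain \<epsilon>' where \<epsilon>': "\<epsilon>' > 0"
    "\<And>t. 0 < t \<Longrightarrow> t < \<epsilon>' \<Longrightarrow> \<gamma> (- t) \<in> interior K1 \<and> \<gamma> t \<in> interior K2"
    unfolding eventually_at_right_field by auto
  obtain A where AB: "A ** B = mat 1" "B ** A = mat 1" using B(1) unfolding invertible_def by blast
  define \<phi> where "\<phi> x = A *v x" for x
  have "invertible A" using AB invertible_def by blast
  then have "invertible_affine \<phi>"
    unfolding invertible_affine_def by (intro exI[of _ A] exI[of _ 0]) (auto simp: \<phi>_def)
  have "linear \<phi>" unfolding \<phi>_def by (rule matrix_vector_mul_linear)
  moreover have "inj \<phi>"
    by (rule inj_on_inverseI[of _ "(*v) B"]) (simp add: \<phi>_def matrix_vector_mul_assoc AB)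
  ultimately have int: "interior (\<phi> ` K) = \<phi> ` interior K" for K
    by (rule interior_injective_linear_image)
  have \<beta>: "\<beta> t = \<phi> (\<gamma> t)" for t
    by (simp add: \<phi>_def matrix_vector_mul_assoc AB flip: B\<beta>)
  have \<phi>0: "\<phi> 0 = 0" by (simp add: \<phi>_def)
  have left: "\<beta> ` {-(\<epsilon>' / 2)..<0} \<subseteq> interior (\<phi> ` K1)"
  proof
    fix y assume "y \<in> \<beta> ` {-(\<epsilon>' / 2)..<0}"
    then obtain t where "y = \<phi> (\<gamma> t)" "- (\<epsilon>' / 2) \<le> t" "t < 0" unfolding \<beta> by auto
    then show "y \<in> interior (\<phi> ` K1)" using \<epsilon>'(2)[of "- t"] \<epsilon>'(1) unfolding int by auto
  qed
  have right: "\<beta> ` {0<..\<epsilon>' / 2} \<subseteq> interior (\<phi> ` K2)"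
  proof
    fix y assume "y \<in> \<beta> ` {0<..\<epsilon>' / 2}"
    then obtain t where "y = \<phi> (\<gamma> t)" "0 < t" "t \<le> \<epsilon>' / 2" unfolding \<beta> by auto
    then show "y \<in> interior (\<phi> ` K2)" using \<epsilon>'(2)[of t] \<epsilon>'(1) unfolding int by auto
  qed
  have "\<beta> 0 = 0" by (simp add: \<beta> \<gamma>0 \<phi>0)
  then have "\<beta> 0 \<in> \<phi> ` K1" using assms(6) \<phi>0 by (metis IntD1 imageI)
  moreover have "{-(\<epsilon>' / 2)..\<epsilon>' / 2} = {-(\<epsilon>' / 2)..<0} \<union> {0} \<union> {0<..\<epsilon>' / 2}"
    using \<epsilon>'(1) by auto
  ultimately have "\<beta> ` {-(\<epsilon>' / 2)..\<epsilon>' / 2} \<subseteq> \<phi> ` K1 \<union> \<phi> ` K2"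
    using left right interior_subset by (simp add: image_Un) blast
  then have "let \<beta> = power_arc pos e (length vs) in
      \<beta> ` {-(\<epsilon>' / 2)..\<epsilon>' / 2} \<subseteq> \<phi> ` K1 \<union> \<phi> ` K2 \<and> \<beta> 0 = 0 \<and>
      \<beta> ` {-(\<epsilon>' / 2)..<0} \<subseteq> interior (\<phi> ` K1) \<and> \<beta> ` {0<..\<epsilon>' / 2} \<subseteq> interior (\<phi> ` K2)"
    using \<open>\<beta> 0 = 0\<close> left right by (simp add: Let_def \<beta>_def)
  moreover have "\<epsilon>' / 2 > 0" using \<epsilon>'(1) by simp
  ultimately show ?thesis
    using e \<open>e \<le> length ys\<close> d_le \<open>invertible_affine \<phi>\<close> \<phi>0 unfolding len
    by (intro bexI[of _ e] exI[of _ "length ys"] exI[of _ "\<epsilon>' / 2"] exI[of _ \<phi>] conjI)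
qed

end
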